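(* There exists an algorithm that, given a word $w\in\Sigma^n$ (with $\Sigma=\{1,\dots,\sigma\}$) and $k\in\mathbb N$, computes the rollercoaster table $R_w^k$ in $O(n\sigma k)$ time.
   Context: Words are finite sequences over the ordered alphabet $\Sigma=\{1,\dots,\sigma\}$ (usual order), $\Sigma$ being the set of letters of the input word; $\mathrm{letters}(u)$ is the set of distinct letters of $u$. A subsequence of $w$ is $w[i_1]\cdots w[i_t]$ with $i_1<\dots<i_t$. A factor $u=w[i,j]$ is a plateau-run if it is weakly increasing (orientation $\uparrow$) or weakly decreasing (orientation $\downarrow$); an increasing plateau-run $w[i,j]$ is maximal if ($i=1$ or $w[i-1]>w[i]$) and ($j=|w|$ or $w[j]>w[j+1]$), symmetrically for decreasing ones. A plateau-run $u$ is a plateau-$k$-run if $|\mathrm{letters}(u)|\ge k$. For $\xi\in\{\uparrow,\downarrow\}$, $h\in[k]$, a word is a plateau-$(k,h)_\xi$-rollercoaster if, decomposing it into its maximal plateau-runs $r_1,\dots,r_x$ (consecutive runs alternate orientation and overlap in their common plateau), $r_x$ has orientation $\xi$, $r_1,\dots,r_{x-1}$ are plateau-$k$-runs and $r_x$ is a plateau-$h$-run (a plateau-$k$-run if $h=k$); a final letter/plateau may also count as a run of the opposite orientation (e.g. $43321$ is a plateau-$(3,3)_\downarrow$- and a plateau-$(3,1)_\uparrow$-rollercoaster). The rollercoaster table $R_w^k$ is the $n\times 2\times k$ table indexed by $i\in[1,n]$, $\xi\in\{\uparrow,\downarrow\}$, $h\in[1,k]$, where $R_w^k[i,\xi,h]$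 is the number of subsequences $s$ of $w$ which are plateau-$(k,h)_\xi$-rollercoasters ending at position $i$ of $w$ (i.e. $w[i]$ is the last symbol of $s$). Model: word RAM with logarithmic word size.
   Formalization: The model is a unit-cost RAM with unbounded cells (addition and truncated subtraction only) instead of a word RAM with logarithmic word size, since table entries can have about n bits (e.g. 2^(i-1) for w=1^n, k=1); subsequences are counted by their position sets. *)

theory Defs
  imports Main
begin

text \<open>Words are lists of naturals; positions are 0-based (position i of the paper is i+1 here).\<close>

datatype orient = Up | Down

definition factor :: "nat list \<Rightarrow> nat \<Rightarrow> nat \<Rightarrow> nat list" where
  "factor s a b = take (Suc b - a) (drop a s)"

definition letters :: "nat list \<Rightarrow> nat set" where
  "letters u = set u"

definition monotone_factor :: "orient \<Rightarrow> nat list \<Rightarrow> nat \<Rightarrow> nat \<Rightarrow> bool" where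
  "monotone_factor ori s a b \<longleftrightarrow>
     (\<forall>j. a \<le> j \<longrightarrow> j < b \<longrightarrow>
        (if ori = Up then s ! j \<le> s ! Suc j else s ! j \<ge> s ! Suc j))"

definition maximal_run :: "orient \<Rightarrow> nat list \<Rightarrow> nat \<Rightarrow> nat \<Rightarrow> bool" where
  "maximal_run ori s a b \<longleftrightarrow>
     a \<le> b \<and> b < length s \<and> monotone_factor ori s a b \<and>
     (if ori = Up then (a = 0 \<or> s ! (a - 1) > s ! a) \<and> (Suc b = length s \<or> s ! b > s ! Suc b)
                else (a = 0 \<or> s ! (a - 1) < s ! a) \<and> (Suc b = length s \<or> s ! b < s ! Suc b))"

text \<open>
  A word s is a plateau-(k,h)_xi-rollercoaster iff it admits a decomposition into maximal
  plateau-runs r_1..r_x (given as triples (start, end, orientation)) such that r_1 starts at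
  the first position, r_x ends at the last position, consecutive runs alternate orientation and
  overlap (each next run starts strictly after the previous one starts, no later than the
  previous one ends, and ends no earlier), r_x has orientation xi, r_1..r_{x-1} contain at least
  k distinct letters and r_x contains at least h distinct letters.  Allowing the last run to end
  where the previous one ends realises the convention that a final plateau may count as a run
  of the opposite orientation.
\<close>
definition plateau_rollercoaster :: "nat \<Rightarrow> nat \<Rightarrow> orient \<Rightarrow> nat list \<Rightarrow> bool" where
  "plateau_rollercoaster k h xi s \<longleftrightarrow>
     (\<exists>rs :: (nat \<times> nat \<times> orient) list.
        rs \<noteq> [] \<and>
        fst (hd rs) = 0 \<and>
        fst (snd (last rs)) = length s - 1 \<and>
        snd (snd (last rs)) = xi \<and>
        (\<forall>t < length rs.
           maximal_run (snd (snd (rs ! t))) s (fst (rs ! t)) (fst (snd (rs ! t))) \<and>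
           (if Suc t < length rs
            then k \<le> card (letters (factor s (fst (rs ! t)) (fst (snd (rs ! t)))))
            else h \<le> card (letters (factor s (fst (rs ! t)) (fst (snd (rs ! t))))))) \<and>
        (\<forall>t. Suc t < length rs \<longrightarrow>
           snd (snd (rs ! Suc t)) \<noteq> snd (snd (rs ! t)) \<and>
           fst (rs ! t) < fst (rs ! Suc t) \<and>
           fst (rs ! Suc t) \<le> fst (snd (rs ! t)) \<and>
           fst (snd (rs ! t)) \<le> fst (snd (rs ! Suc t))))"

definition rc_table :: "nat list \<Rightarrow> nat \<Rightarrow> nat \<Rightarrow> orient \<Rightarrow> nat \<Rightarrow> nat" where
  "rc_table w k i xi h =
     card {I. I \<subseteq> {0..<length w} \<and> I \<noteq> {} \<and> Max I = i \<and>
              plateau_rollercoaster k h xi (nths w I)}"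

datatype instr =
    LoadC nat nat
  | Add nat nat nat
  | Sub nat nat nat
  | LoadI nat nat
  | StoreI nat nat
  | JLe nat nat nat
  | Halt

type_synonym mem = "nat \<Rightarrow> nat"
type_synonym config = "nat \<times> mem"

definition halted :: "instr list \<Rightarrow> config \<Rightarrow> bool" where
  "halted P c \<longleftrightarrow> fst c \<ge> length P \<or> P ! fst c = Halt"

fun step :: "instr list \<Rightarrow> config \<Rightarrow> config" where
  "step P (pc, m) =
     (if pc \<ge> length P then (pc, m) else
      (case P ! pc of
         LoadC a c \<Rightarrow> (Suc pc, m(a := c))
       | Add a b c \<Rightarrow> (Suc pc, m(a := m b + m c))
       | Sub a b c \<Rightarrow> (Suc pc, m(a := m b - m c))
       | LoadI a b \<Rightarrow> (Suc pc, m(a := m (m b)))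
       | StoreI a b \<Rightarrow> (Suc pc, m(m a := m b))
       | JLe a b t \<Rightarrow> (if m a \<le> m b then (t, m) else (Suc pc, m))
       | Halt \<Rightarrow> (pc, m)))"

definition exec :: "instr list \<Rightarrow> nat \<Rightarrow> config \<Rightarrow> config" where
  "exec P t c = (step P ^^ t) c"

definition init_mem :: "nat list \<Rightarrow> nat \<Rightarrow> mem" where
  "init_mem w k = (\<lambda>a. if a = 0 then length w else if a = 1 then k
                       else if a < 2 + length w then w ! (a - 2) else 0)"

definition orient_code :: "orient \<Rightarrow> nat" where
  "orient_code xi = (if xi = Up then 0 else 1)"

definition out_addr :: "nat \<Rightarrow> nat \<Rightarrow> nat \<Rightarrow> orient \<Rightarrow> nat \<Rightarrow> nat" where
  "out_addr n k i xi h = 2 + n + (2 * i + orient_code xi) * k + (h - 1)"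

definition computes_table_within :: "instr list \<Rightarrow> nat list \<Rightarrow> nat \<Rightarrow> nat \<Rightarrow> bool" where
  "computes_table_within P w k T \<longleftrightarrow>
     (\<exists>t \<le> T. halted P (exec P t (0, init_mem w k)) \<and>
        (\<forall>i < length w. \<forall>xi. \<forall>h \<in> {1..k}.
           snd (exec P t (0, init_mem w k)) (out_addr (length w) k i xi h) = rc_table w k i xi h))"

end

theory Submission
  imports Defs
begin

text \<open>Appending a letter \<open>y\<close> to a nonempty word \<open>s\<close> keeps its state if \<open>y\<close> repeats the last letter, adds one
  letter to the last run if \<open>y\<close> continues its direction, and turns the direction otherwise, which
  is possible only after \<open>k\<close> letters. With \<open>T i d g\<close> the table entry for \<open>h = g + 1\<close>, \<open>S a d g\<close> the sum of
  \<open>T j d g\<close> over the earlier positions \<open>j\<close> that carry the letter \<open>a\<close>, and \<open>x\<close> the letter at \<open>i\<close>, this gives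
  \<open>T i Up g = S x Up g + (\<Sum>a<x. S a Up (g - 1)) + [g = 0] (1 + (\<Sum>a>x. S a Down (k - 2)))\<close>
  with truncated subtraction, and symmetrically for \<open>Down\<close>: a one-letter run is a turning point
  of a full run, which had \<open>k - 1\<close> letters before \<open>i\<close>. Keeping the array \<open>S\<close> up to date, each entry
  costs \<open>O(\<sigma>)\<close> steps.

  Every address of the machine is shared with the input or the output. The program therefore
  first moves the cells that serve as registers out of the way, computes the table at higher
  addresses, and finally copies it down, ending with the register cells themselves.\<close>

subsection \<open>Runs of a word extended by one letter\<close>

text \<open>The delicate point about runs is that a chain may end with a run inside the final
  plateau of its predecessor. The next letter can destroy such a run, so the chains of
  \<open>s @ [y]\<close> are not simply those of \<open>s\<close> with one run prolonged. Chains are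
  therefore followed through their last run, by induction along the chain, with separate arguments
  for a repeated and for a different letter.

  The alphabet size is not part of the input, and the machine cannot multiply. Blocks of
  \<open>S\<close> are located by repeated addition, at a cost proportional to the letter, and sums
  over larger letters stop behind the largest letter seen so far. \<open>S\<close> occupies memory
  that is still zero and needs no initialisation. Updating it in place is sound because at a letter
  \<open>x\<close> only the two blocks of \<open>x\<close> change, while the range sums read blocks
  of other letters; so the \<open>Down\<close> half can follow the \<open>Up\<close> half without a
  second copy of \<open>S\<close>.\<close>

definition ordle :: "orient \<Rightarrow> nat \<Rightarrow> nat \<Rightarrow> bool" where
  "ordle d x y \<longleftrightarrow> (if d = Up then x \<le> y else y \<le> x)"

fun opp :: "orient \<Rightarrow> orient" where
  "opp Up = Down"
| "opp Down = Up"

text \<open>Strictness is the failure of the opposite weak order, because this is the condition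
  under which a run of direction \<open>opp d\<close> ends.\<close>

definition ordlt :: "orient \<Rightarrow> nat \<Rightarrow> nat \<Rightarrow> bool" where
  "ordlt d x y \<longleftrightarrow> \<not> ordle (opp d) x y"

lemma neq_orient_iff: "d' \<noteq> d \<longleftrightarrow> d' = opp d"
  by (cases d; cases d') auto

lemma opp_opp [simp]: "opp (opp d) = d"
  by (cases d) auto

lemma opp_neq [simp]: "opp d \<noteq> d" "d \<noteq> opp d"
  by (cases d; simp)+

lemma ordle_refl [simp]: "ordle d x x"
  by (simp add: ordle_def)

lemma ordlt_imp_le: "ordlt d x y \<Longrightarrow> ordle d x y"
  by (cases d) (auto simp: ordle_def ordlt_def)

lemma ordle_trans: "ordle d x y \<Longrightarrow> ordle d y z \<Longrightarrow> ordle d x z"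
  by (auto simp: ordle_def split: if_splits)

lemma maximal_run_iff:
  "maximal_run d s a b \<longleftrightarrow>
     a \<le> b \<and> b < length s \<and> (\<forall>j. a \<le> j \<longrightarrow> j < b \<longrightarrow> ordle d (s ! j) (s ! Suc j)) \<and>
     (a = 0 \<or> \<not> ordle d (s ! (a - 1)) (s ! a)) \<and>
     (Suc b = length s \<or> \<not> ordle d (s ! b) (s ! Suc b))"
  by (auto simp: maximal_run_def monotone_factor_def ordle_def not_le)

definition run_letters :: "nat list \<Rightarrow> nat \<Rightarrow> nat \<Rightarrow> nat set" where
  "run_letters s a b = (!) s ` {a..b}"

lemma letters_factor:
  assumes "a \<le> b" "b < length s"
  shows "letters (factor s a b) = run_letters s a b"
proof -
  have "factor s a b = map ((!) s) [a..<Suc b]"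
    unfolding factor_def using assms by (intro nth_equalityI) (auto simp del: upt_Suc)
  thus ?thesis
    by (simp add: letters_def run_letters_def atLeastLessThanSuc_atLeastAtMost del: upt_Suc)
qed

text \<open>\<open>final_run k s a b d\<close>: some chain of maximal runs as in the definition of rollercoasters,
  with all runs but the last one containing \<open>k\<close> letters, has \<open>(a, b, d)\<close> as its last run.\<close>

inductive final_run :: "nat \<Rightarrow> nat list \<Rightarrow> nat \<Rightarrow> nat \<Rightarrow> orient \<Rightarrow> bool" for k s where
  first: "maximal_run d s 0 b \<Longrightarrow> final_run k s 0 b d"
| next_run: "final_run k s a b d \<Longrightarrow> k \<le> card (run_letters s a b) \<Longrightarrow> maximal_run (opp d) s a' b' \<Longrightarrow>
     a < a' \<Longrightarrow> a' \<le> b \<Longrightarrow> b \<le> b' \<Longrightarrow> final_run k s a' b' (opp d)"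

text \<open>The demand on the letters of the last run is left out. Every nonempty prefix of a chain
  is then a chain again, and lists can be analysed from the right.\<close>

definition run_chain :: "nat \<Rightarrow> nat list \<Rightarrow> (nat \<times> nat \<times> orient) list \<Rightarrow> bool" where
  "run_chain k s rs \<longleftrightarrow>
     rs \<noteq> [] \<and> fst (hd rs) = 0 \<and>
     (\<forall>t < length rs. maximal_run (snd (snd (rs ! t))) s (fst (rs ! t)) (fst (snd (rs ! t)))) \<and>
     (\<forall>t. Suc t < length rs \<longrightarrow>
        k \<le> card (run_letters s (fst (rs ! t)) (fst (snd (rs ! t)))) \<and>
        snd (snd (rs ! Suc t)) = opp (snd (snd (rs ! t))) \<and>
        fst (rs ! t) < fst (rs ! Suc t) \<and>
        fst (rs ! Suc t) \<le> fst (snd (rs ! t)) \<and>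
        fst (snd (rs ! t)) \<le> fst (snd (rs ! Suc t)))"

lemma maximal_runD: "maximal_run d s a b \<Longrightarrow> a \<le> b \<and> b < length s"
  by (simp add: maximal_run_def)

lemma plateau_rollercoaster_iff_run_chain:
  "plateau_rollercoaster k h xi s \<longleftrightarrow>
     (\<exists>rs a. run_chain k s rs \<and> last rs = (a, length s - 1, xi) \<and>
        h \<le> card (run_letters s a (length s - 1)))"
proof
  assume "plateau_rollercoaster k h xi s"
  then obtain rs where rs: "rs \<noteq> []" "fst (hd rs) = 0" "fst (snd (last rs)) = length s - 1"
    "snd (snd (last rs)) = xi"
    and 1: "\<And>t. t < length rs \<Longrightarrow> maximal_run (snd (snd (rs ! t))) s (fst (rs ! t)) (fst (snd (rs ! t)))"
    and 2: "\<And>t. t < length rs \<Longrightarrow>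
      (if Suc t < length rs then k else h) \<le> card (letters (factor s (fst (rs ! t)) (fst (snd (rs ! t)))))"
    and 3: "\<And>t. Suc t < length rs \<Longrightarrow> snd (snd (rs ! Suc t)) \<noteq> snd (snd (rs ! t)) \<and>
           fst (rs ! t) < fst (rs ! Suc t) \<and>
           fst (rs ! Suc t) \<le> fst (snd (rs ! t)) \<and>
           fst (snd (rs ! t)) \<le> fst (snd (rs ! Suc t))"
    unfolding plateau_rollercoaster_def by (smt (verit))
  have 4: "(if Suc t < length rs then k else h) \<le> card (run_letters s (fst (rs ! t)) (fst (snd (rs ! t))))"
    if "t < length rs" for t
    using 2[OF that] maximal_runD[OF 1[OF that]] by (simp add: letters_factor)
  have "run_chain k s rs"
    unfolding run_chain_def
  proof (intro conjI allI impI)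
    fix t assume t: "Suc t < length rs"
    show "k \<le> card (run_letters s (fst (rs ! t)) (fst (snd (rs ! t))))"
      using 4[of t] t by simp
  qed (use rs 1 3 in \<open>auto simp: neq_orient_iff\<close>)
  moreover have "last rs = (fst (last rs), length s - 1, xi)"
    using rs by (metis prod.collapse)
  moreover have "h \<le> card (run_letters s (fst (last rs)) (length s - 1))"
    using 4[of "length rs - 1"] rs by (simp add: last_conv_nth)
  ultimately show "\<exists>rs a. run_chain k s rs \<and> last rs = (a, length s - 1, xi) \<and>
        h \<le> card (run_letters s a (length s - 1))" by blast
next
  assume "\<exists>rs a. run_chain k s rs \<and> last rs = (a, length s - 1, xi) \<and>
        h \<le> card (run_letters s a (length s - 1))"
  then obtain rs a where rs: "run_chain k s rs" "last rs = (a, length s - 1, xi)"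
    "h \<le> card (run_letters s a (length s - 1))" by blast
  show "plateau_rollercoaster k h xi s"
    unfolding plateau_rollercoaster_def
  proof (intro exI[of _ rs] conjI allI impI)
    fix t assume t: "t < length rs"
    have m: "maximal_run (snd (snd (rs ! t))) s (fst (rs ! t)) (fst (snd (rs ! t)))"
      using rs t by (simp add: run_chain_def)
    have "t = length rs - 1" if "\<not> Suc t < length rs" using that t by simp
    thus "if Suc t < length rs
            then k \<le> card (letters (factor s (fst (rs ! t)) (fst (snd (rs ! t)))))
            else h \<le> card (letters (factor s (fst (rs ! t)) (fst (snd (rs ! t)))))"
      using maximal_runD[OF m] rs by (auto simp: letters_factor run_chain_def last_conv_nth)
  qed (use rs in \<open>auto simp: run_chain_def\<close>)
qed

lemma run_chain_snoc:
  assumes "rs \<noteq> []"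
  shows "run_chain k s (rs @ [(a', b', d')]) \<longleftrightarrow>
     run_chain k s rs \<and> maximal_run d' s a' b' \<and>
     (case last rs of (a, b, d) \<Rightarrow> k \<le> card (run_letters s a b) \<and> d' = opp d \<and> a < a' \<and> a' \<le> b \<and> b \<le> b')"
    (is "?L \<longleftrightarrow> ?R")
proof -
  obtain a b d where l: "last rs = (a, b, d)" by (metis prod_cases3)
  obtain n where n: "length rs = Suc n" using assms by (cases rs) auto
  have ln: "rs ! n = (a, b, d)" using l n assms by (simp add: last_conv_nth)
  have len: "length (rs @ [(a', b', d')]) = Suc (Suc n)" using n by simp
  show ?thesis
    unfolding run_chain_def len n All_less_Suc2 less_Suc_eq Suc_less_eq
    using n l ln assms
    by (simp add: nth_append all_conj_distrib imp_conjL less_Suc_eq) (auto simp: nth_append)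
qed

lemma run_chain_imp_final_run:
  "run_chain k s rs \<Longrightarrow> last rs = (a, b, d) \<Longrightarrow> final_run k s a b d"
proof (induction rs arbitrary: a b d rule: rev_induct)
  case Nil
  thus ?case by (simp add: run_chain_def)
next
  case (snoc r rs)
  show ?case
  proof (cases "rs = []")
    case True
    thus ?thesis using snoc.prems by (auto simp: run_chain_def intro: final_run.first)
  next
    case False
    obtain a1 b1 d1 where l: "last rs = (a1, b1, d1)" by (metis prod_cases3)
    have "run_chain k s rs" "maximal_run d s a b" "k \<le> card (run_letters s a1 b1)" "d = opp d1"
      "a1 < a" "a \<le> b1" "b1 \<le> b"
      using snoc.prems run_chain_snoc[OF False, of k s a b d] l by auto
    thus ?thesis using snoc.IH[OF _ l] by (auto intro: final_run.next_run)
  qed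
qed

lemma final_run_imp_run_chain:
  "final_run k s a b d \<Longrightarrow> \<exists>rs. run_chain k s rs \<and> last rs = (a, b, d)"
proof (induction rule: final_run.induct)
  case (first d b)
  show ?case by (rule exI[of _ "[(0, b, d)]"]) (use first in \<open>simp add: run_chain_def\<close>)
next
  case (next_run a b d a' b')
  then obtain rs where rs: "run_chain k s rs" "last rs = (a, b, d)" by blast
  have "rs \<noteq> []" using rs by (simp add: run_chain_def)
  hence "run_chain k s (rs @ [(a', b', opp d)])"
    using rs next_run by (simp add: run_chain_snoc)
  thus ?case by (intro exI) auto
qed

lemma plateau_rollercoaster_iff_final_run:
  "plateau_rollercoaster k h xi s \<longleftrightarrow>
     (\<exists>a. final_run k s a (length s - 1) xi \<and> h \<le> card (run_letters s a (length s - 1)))"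
  unfolding plateau_rollercoaster_iff_run_chain
  using run_chain_imp_final_run final_run_imp_run_chain by meson

section \<open>Maximal runs and their letters when a letter is appended\<close>

lemma maximal_run_snoc_inner:
  "Suc b < length s \<Longrightarrow> maximal_run d (s @ [y]) a b \<longleftrightarrow> maximal_run d s a b"
  by (auto simp: maximal_run_iff nth_append)

lemma maximal_run_snoc_before_last:
  assumes "s \<noteq> []"
  shows "maximal_run d (s @ [y]) a (length s - Suc 0) \<longleftrightarrow>
    maximal_run d s a (length s - Suc 0) \<and> \<not> ordle d (last s) y"
  using assms by (cases "length s") (auto simp: maximal_run_iff nth_append last_conv_nth)

lemma maximal_run_snoc_last:
  assumes "s \<noteq> []"
  shows "maximal_run d (s @ [y]) a (length s) \<longleftrightarrow>
    a = length s \<and> \<not> ordle d (last s) y \<or>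
    a < length s \<and> ordle d (last s) y \<and> maximal_run d s a (length s - 1)"
proof -
  obtain n where n: "length s = Suc n" using assms by (cases s) auto
  show ?thesis
  proof (cases "a \<le> n")
    case True
    have "(\<forall>j. a \<le> j \<longrightarrow> j < Suc n \<longrightarrow> ordle d ((s @ [y]) ! j) ((s @ [y]) ! Suc j)) \<longleftrightarrow>
        (\<forall>j. a \<le> j \<longrightarrow> j < n \<longrightarrow> ordle d (s ! j) (s ! Suc j)) \<and> ordle d (s ! n) y"
    proof -
      have *: "(\<forall>j. a \<le> j \<longrightarrow> j < Suc n \<longrightarrow> Q j) \<longleftrightarrow> (\<forall>j. a \<le> j \<longrightarrow> j < n \<longrightarrow> Q j) \<and> Q n" for Q
        using True less_Suc_eq by auto
      have "(s @ [y]) ! j = s ! j" if "j \<le> n" for j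
        using that n by (simp add: nth_append)
      moreover have "(s @ [y]) ! Suc n = y" using n by (simp add: nth_append)
      ultimately show ?thesis unfolding * by simp
    qed
    moreover have "(s @ [y]) ! (a - 1) = s ! (a - 1)" "(s @ [y]) ! a = s ! a"
      using n True by (auto simp: nth_append)
    moreover have "last s = s ! n" using n assms by (simp add: last_conv_nth)
    ultimately show ?thesis
      unfolding maximal_run_iff n using n True by auto
  next
    case False
    hence "a = Suc n \<or> a > Suc n" by auto
    moreover have "last s = s ! n" using n assms by (simp add: last_conv_nth)
    ultimately show ?thesis
      unfolding maximal_run_iff n using n by (auto simp: nth_append)
  qed
qed

lemma run_letters_snoc:
  "b < length s \<Longrightarrow> run_letters (s @ [y]) a b = run_letters s a b"
  by (auto simp: run_letters_def nth_append)

lemma run_letters_snoc_last: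
  assumes "a < length s"
  shows "run_letters (s @ [y]) a (length s) = insert y (run_letters s a (length s - 1))"
proof -
  have "{a..length s} = insert (length s) {a..length s - 1}" using assms by auto
  thus ?thesis using assms by (auto simp: run_letters_def nth_append)
qed

lemma run_letters_snoc_last_letter:
  assumes "a < length s"
  shows "run_letters (s @ [last s]) a (length s) = run_letters s a (length s - 1)"
proof -
  have "last s = s ! (length s - 1)" using assms by (intro last_conv_nth) auto
  hence "last s \<in> run_letters s a (length s - 1)" using assms by (auto simp: run_letters_def)
  thus ?thesis using assms by (simp add: run_letters_snoc_last insert_absorb)
qed

text \<open>The step into \<open>a'\<close> lies inside the first run and follows its direction, so
  no maximal run of the same direction can start there.\<close>

lemma maximal_run_disjoint:
  assumes "maximal_run d s a b" "maximal_run d s a' b'" "a < a'" "a' \<le> b"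
  shows False
proof -
  have "ordle d (s ! (a' - 1)) (s ! Suc (a' - 1))"
    using assms unfolding maximal_run_iff
    by (metis Suc_pred diff_Suc_1 le_less_trans less_eq_Suc_le less_nat_zero_code not_less_eq_eq old.nat.exhaust)
  thus False using assms by (auto simp: maximal_run_iff)
qed

lemma final_runD: "final_run k s a b d \<Longrightarrow> maximal_run d s a b"
  by (induction rule: final_run.induct) auto

text \<open>Transitivity along the run. It is needed to see that a letter strictly beyond the last
  one does not occur in the run yet, so that it raises the letter count by exactly one.\<close>

lemma run_letters_bounded:
  assumes "maximal_run d s a b" "z \<in> run_letters s a b"
  shows "ordle d z (s ! b)"
proof -
  obtain j where j: "a \<le> j" "j \<le> b" "z = s ! j" using assms by (auto simp: run_letters_def)
  have "ordle d (s ! j) (s ! b)" using j(2)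
  proof (induction rule: dec_induct)
    case (step i)
    thus ?case using assms(1) j(1) by (auto simp: maximal_run_iff intro: ordle_trans)
  qed simp
  thus ?thesis by (simp add: j)
qed

lemma finite_run_letters [simp]: "finite (run_letters s a b)"
  by (simp add: run_letters_def)

lemma run_letters_nonempty: "a \<le> b \<Longrightarrow> 1 \<le> card (run_letters s a b)"
  by (simp add: Suc_le_eq card_gt_0_iff) (simp add: run_letters_def)

text \<open>A repeated letter moves the end of exactly those runs that reach the last position, in
  both directions, and contributes no new letter. Chains therefore carry over run by run.\<close>

lemma final_run_snoc_last_letter:
  assumes "s \<noteq> []"
  shows "final_run k s a b d \<Longrightarrow>
           final_run k (s @ [last s]) a (if b = length s - 1 then length s else b) d"
proof (induction rule: final_run.induct)
  case (first d b)
  hence "maximal_run d (s @ [last s]) 0 (if b = length s - 1 then length s else b)"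
    using assms maximal_runD[OF first]
    by (auto simp: maximal_run_snoc_last maximal_run_snoc_inner)
  thus ?case by (rule final_run.first)
next
  case (next_run a b d a' b')
  have ab: "a \<le> b" "b < length s" "b' < length s"
    using next_run maximal_runD final_runD by blast+
  let ?f = "\<lambda>b. if b = length s - 1 then length s else b"
  have "maximal_run (opp d) (s @ [last s]) a' (?f b')"
    using assms next_run ab by (auto simp: maximal_run_snoc_last maximal_run_snoc_inner)
  moreover have "run_letters (s @ [last s]) a (?f b) = run_letters s a b"
    using ab by (simp add: run_letters_snoc run_letters_snoc_last_letter)
  ultimately show ?case
    using next_run ab by (intro final_run.next_run[OF next_run.IH]) auto
qed

text \<open>The repeated letter continues runs of both directions, so in the longer word no run
  stops just before it and none starts at it. This makes the passage of the preceding lemma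
  reversible.\<close>

lemma final_run_snoc_last_letterD:
  assumes "s \<noteq> []"
  shows "final_run k (s @ [last s]) a b d \<Longrightarrow>
           b \<noteq> length s - 1 \<and> a < length s \<and> final_run k s a (if b = length s then length s - 1 else b) d"
proof (induction rule: final_run.induct)
  have run: "b \<noteq> length s - 1 \<and> a < length s \<and>
      maximal_run d s a (if b = length s then length s - 1 else b)"
    if "maximal_run d (s @ [last s]) a b" for a b d
  proof -
    have "Suc b < length s \<or> b = length s - 1 \<or> b = length s" using maximal_runD[OF that] by auto
    thus ?thesis using that assms maximal_runD[OF that]
      by (auto simp: maximal_run_snoc_last maximal_run_snoc_before_last maximal_run_snoc_inner)
  qed
  {
    case (first d b)
    thus ?case using run[OF first] by (auto intro: final_run.first)
  next
    case (next_run a b d a' b')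
    let ?f = "\<lambda>b. if b = length s then length s - 1 else b"
    have ab: "a \<le> b" "b \<le> length s" "b' \<le> length s"
      using next_run maximal_runD final_runD by fastforce+
    have "run_letters (s @ [last s]) a b = run_letters s a (?f b)"
      using ab next_run.IH by (simp add: run_letters_snoc run_letters_snoc_last_letter)
    hence "final_run k s a' (?f b') (opp d)"
      using next_run ab run[OF next_run(3)]
      by (intro final_run.next_run[of k s a "?f b" d a' "?f b'"]) auto
    thus ?case using run[OF next_run(3)] by simp
  }
qed

lemma rollercoaster_snoc_same:
  assumes "s \<noteq> []"
  shows "plateau_rollercoaster k h xi (s @ [last s]) \<longleftrightarrow> plateau_rollercoaster k h xi s"
proof -
  have *: "run_letters (s @ [last s]) a (length s) = run_letters s a (length s - 1)"
    if "a < length s" for a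
    using that by (rule run_letters_snoc_last_letter)
  have "final_run k (s @ [last s]) a (length s) xi \<longleftrightarrow> a < length s \<and> final_run k s a (length s - 1) xi" for a
    using final_run_snoc_last_letter[OF assms, of k a "length s - 1" xi]
      final_run_snoc_last_letterD[OF assms, of k a "length s" xi]
      maximal_runD[OF final_runD, of k s a "length s - 1" xi] by auto
  moreover have "final_run k s a (length s - 1) xi \<Longrightarrow> a < length s" for a
    using final_runD maximal_runD by fastforce
  ultimately show ?thesis
    unfolding plateau_rollercoaster_iff_final_run by simp (metis *[simplified])
qed

text \<open>A run of direction \<open>opp d\<close> that consists of the final plateau only is lost when a letter
  strictly in direction \<open>d\<close> is appended.\<close>

lemma final_run_snoc_strict:
  assumes "s \<noteq> []" and lt: "ordlt d (last s) y"
  shows "final_run k s a b e \<Longrightarrow>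
           final_run k (s @ [y]) a (if b = length s - 1 \<and> e = d then length s else b) e \<or>
           b = length s - 1 \<and> e = opp d \<and> (\<exists>a0<a. maximal_run d s a0 b)"
proof (induction rule: final_run.induct)
  let ?f = "\<lambda>b e. if b = length s - 1 \<and> e = d then length s else b"
  have run: "maximal_run e (s @ [y]) a (?f b e)" if "maximal_run e s a b" for a b e
  proof -
    have "Suc b < length s \<or> b = length s - 1" using maximal_runD[OF that] by auto
    thus ?thesis using that assms ordlt_imp_le[OF lt] maximal_runD[OF that]
      by (cases "e = d")
         (auto simp: maximal_run_snoc_last maximal_run_snoc_before_last maximal_run_snoc_inner ordlt_def
            neq_orient_iff)
  qed
  {
    case (first e b)
    show ?case using final_run.first[OF run[OF first]] by blast
  next
    case (next_run a b e a' b')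
    have ab: "a \<le> b" "b < length s" "b' < length s" and ma: "maximal_run e s a b"
      using next_run maximal_runD final_runD by blast+
    show ?case
    proof (cases "b = length s - 1")
      case False
      hence IH: "final_run k (s @ [y]) a b e" using next_run.IH by simp
      have "final_run k (s @ [y]) a' (?f b' (opp e)) (opp e)"
        by (rule final_run.next_run[OF IH]) (use next_run ab run in \<open>auto simp: run_letters_snoc\<close>)
      thus ?thesis by simp
    next
      case b: True
      hence b': "b' = length s - 1" using next_run ab by simp
      show ?thesis
      proof (cases "e = d")
        case True
        \<comment> \<open>The predecessor has direction \<open>d\<close> and reaches the last
          position, so \<open>y\<close> prolongs it beyond its successor. This is the lost case,
          with the predecessor as witness.\<close>
        thus ?thesis using b b' ma next_run by auto
      next
        case False
        hence e: "e = opp d" by (simp add: neq_orient_iff)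
        \<comment> \<open>The predecessor cannot be lost itself: that would take a maximal
          \<open>d\<close>-run reaching \<open>b\<close>, and the present run is a maximal
          \<open>d\<close>-run starting strictly inside it.\<close>
        have "\<not> (\<exists>a0<a. maximal_run d s a0 b)"
          using maximal_run_disjoint[of d s _ b a' b'] next_run e by force
        hence IH: "final_run k (s @ [y]) a b e" using next_run.IH e by auto
        have "final_run k (s @ [y]) a' (?f b' (opp e)) (opp e)"
          by (rule final_run.next_run[OF IH]) (use next_run ab run[OF next_run(3)] in \<open>auto simp: run_letters_snoc\<close>)
        thus ?thesis by simp
      qed
    qed
  }
qed

text \<open>The premise on \<open>b\<close> and \<open>e\<close> excludes only the run of direction
  \<open>opp d\<close> that consists of \<open>y\<close> alone; every other run stems from a run of
  \<open>s\<close>.\<close>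

lemma final_run_snoc_strictD:
  assumes "s \<noteq> []" and lt: "ordlt d (last s) y"
  shows "final_run k (s @ [y]) a b e \<Longrightarrow> b < length s \<or> e = d \<Longrightarrow>
           a < length s \<and> final_run k s a (if b = length s then length s - 1 else b) e"
proof (induction rule: final_run.induct)
  let ?f = "\<lambda>b. if b = length s then length s - 1 else b"
  have run: "a < length s \<and> maximal_run e s a (?f b)"
    if "maximal_run e (s @ [y]) a b" "b < length s \<or> e = d" for a b e
  proof -
    have "Suc b < length s \<or> b = length s - 1 \<or> b = length s" using maximal_runD[OF that(1)] by auto
    thus ?thesis using that assms ordlt_imp_le[OF lt] maximal_runD[OF that(1)]
      by (auto simp: maximal_run_snoc_last maximal_run_snoc_before_last maximal_run_snoc_inner ordlt_def)
  qed
  {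
    case (first e b)
    show ?case using run[OF first] by (auto intro: final_run.first)
  next
    case (next_run a b e a' b')
    have ma: "maximal_run e (s @ [y]) a b" using next_run final_runD by blast
    have r: "a' < length s" "maximal_run (opp e) s a' (?f b')"
      using run[OF next_run(3)] next_run.prems by auto
    have ab: "a \<le> b" "b' \<le> length s" using next_run ma maximal_runD by fastforce+
    \<comment> \<open>If the predecessor reached \<open>y\<close>, its successor would do so too and
      have direction \<open>d\<close>. The predecessor, of direction \<open>opp d\<close>, would
      then consist of \<open>y\<close> alone and could not start before its successor.\<close>
    have b: "b < length s"
    proof (rule ccontr)
      assume "\<not> b < length s"
      hence "b = length s" "b' = length s" using ab next_run by auto
      moreover have "e = opp d" using next_run.prems \<open>b' = length s\<close> by (metis less_irrefl opp_opp)
      ultimately have "a = length s"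
        using ma lt assms(1) by (auto simp: maximal_run_snoc_last ordlt_def)
      thus False using next_run(4) r by simp
    qed
    have "final_run k s a' (?f b') (opp e)"
      by (rule final_run.next_run[of k s a b]) (use next_run b r in \<open>auto simp: run_letters_snoc\<close>)
    thus ?case using r by simp
  }
qed

text \<open>The new letter adds one to the letter count of the last run. Since every run has a
  letter, the demand \<open>h - 1 = 0\<close> can be raised to one, which keeps the index inside the
  table.\<close>

lemma rollercoaster_snoc_along:
  assumes "s \<noteq> []" and lt: "ordlt d (last s) y"
  shows "plateau_rollercoaster k h d (s @ [y]) \<longleftrightarrow> plateau_rollercoaster k (max 1 (h - 1)) d s"
proof -
  have "final_run k (s @ [y]) a (length s) d \<longleftrightarrow> a < length s \<and> final_run k s a (length s - 1) d" for a
    using final_run_snoc_strict[OF assms, of k a "length s - 1" d]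
      final_run_snoc_strictD[OF assms, of k a "length s" d]
      maximal_runD[OF final_runD, of k s a "length s - 1" d] by auto
  moreover have "h \<le> card (run_letters (s @ [y]) a (length s)) \<longleftrightarrow>
      max 1 (h - 1) \<le> card (run_letters s a (length s - 1))"
    if "final_run k s a (length s - 1) d" for a
  proof -
    have m: "maximal_run d s a (length s - 1)" "a \<le> length s - 1"
      using final_runD[OF that] maximal_runD by auto
    have "y \<notin> run_letters s a (length s - 1)"
    proof
      assume "y \<in> run_letters s a (length s - 1)"
      hence "ordle d y (last s)" using run_letters_bounded[OF m(1)] assms by (simp add: last_conv_nth)
      thus False using lt by (cases d) (auto simp: ordlt_def ordle_def)
    qed
    moreover have "a < length s" using m assms by (cases s) auto
    ultimately have "card (run_letters (s @ [y]) a (length s)) = Suc (card (run_letters s a (length s - 1)))"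
      by (simp add: run_letters_snoc_last)
    thus ?thesis using run_letters_nonempty[OF m(2), of s] by auto
  qed
  moreover have "final_run k s a (length s - 1) d \<Longrightarrow> a < length s" for a
    using final_runD maximal_runD by fastforce
  ultimately show ?thesis unfolding plateau_rollercoaster_iff_final_run by auto
qed

text \<open>A run of direction \<open>opp d\<close> ending at \<open>y\<close> has only the letter
  \<open>y\<close>. Its predecessor must be the \<open>d\<close>-run that also ends at
  \<open>y\<close>; this one needs \<open>k\<close> letters, \<open>y\<close> included.\<close>

lemma rollercoaster_snoc_against:
  assumes "s \<noteq> []" and lt: "ordlt d (last s) y"
  shows "plateau_rollercoaster k h (opp d) (s @ [y]) \<longleftrightarrow>
           h \<le> 1 \<and> plateau_rollercoaster k (max 1 (k - 1)) d s"
proof -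
  have "final_run k (s @ [y]) a (length s) (opp d) \<longleftrightarrow>
      a = length s \<and> (\<exists>a0. final_run k (s @ [y]) a0 (length s) d \<and> k \<le> card (run_letters (s @ [y]) a0 (length s)))"
    (is "?L \<longleftrightarrow> ?R") for a
  proof
    assume L: ?L
    have a: "a = length s" using final_runD[OF L] lt assms(1)
      by (auto simp: maximal_run_snoc_last ordlt_def)
    from L show ?R
    proof cases
      case first
      thus ?thesis using a assms by simp
    next
      case (next_run a0 b e)
      have "e = d" using next_run(1) by (metis opp_opp)
      moreover have "b = length s" using next_run a by simp
      ultimately show ?thesis using a next_run by auto
    qed
  next
    assume ?R
    then obtain a0 where a: "a = length s" and f: "final_run k (s @ [y]) a0 (length s) d"
      and k: "k \<le> card (run_letters (s @ [y]) a0 (length s))" by blast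
    have "a0 < length s"
      using final_runD[OF f] ordlt_imp_le[OF lt] assms(1) by (auto simp: maximal_run_snoc_last)
    thus ?L unfolding a
      using lt assms(1) by (intro final_run.next_run[OF f k]) (auto simp: maximal_run_snoc_last ordlt_def)
  qed
  moreover have "card (run_letters (s @ [y]) (length s) (length s)) = 1"
    by (simp add: run_letters_def)
  ultimately have "plateau_rollercoaster k h (opp d) (s @ [y]) \<longleftrightarrow>
      h \<le> 1 \<and> plateau_rollercoaster k k d (s @ [y])"
    unfolding plateau_rollercoaster_iff_final_run by auto
  thus ?thesis by (simp add: rollercoaster_snoc_along[OF assms])
qed

text \<open>A single letter is a maximal run in both directions, which yields the summand one in
  both halves of the recurrence.\<close>

lemma rollercoaster_singleton: "plateau_rollercoaster k h xi [y] \<longleftrightarrow> h \<le> 1"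
proof -
  have "maximal_run xi [y] 0 0" by (simp add: maximal_run_iff)
  hence "final_run k [y] 0 0 xi" by (rule final_run.first)
  hence "final_run k [y] a 0 xi \<longleftrightarrow> a = 0" for a
    using final_runD maximal_runD by fastforce
  thus ?thesis
    unfolding plateau_rollercoaster_iff_final_run by (auto simp: run_letters_def)
qed

subsection \<open>The recurrence for the table\<close>

lemma nths_eq_Nil: "(\<And>j. j \<in> A \<Longrightarrow> length xs \<le> j) \<Longrightarrow> nths xs A = []"
  using leD by (subst set_empty[symmetric]) (unfold set_nths, blast)

lemma nths_snoc_Max:
  assumes "I \<subseteq> {0..<length w}" "I \<noteq> {}"
  shows "nths w I \<noteq> []" "last (nths w I) = w ! Max I"
proof -
  have fin: "finite I" using assms finite_subset by blast
  define j where "j = Max I"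
  have j: "j \<in> I" "j < length w" "\<And>x. x \<in> I \<Longrightarrow> x \<le> j"
    using fin assms Max_in[OF fin] unfolding j_def by auto
  have "nths w I = nths (take (Suc j) w @ drop (Suc j) w) I" by (simp only: append_take_drop_id)
  also have "\<dots> = nths (take (Suc j) w) I"
    unfolding nths_append using j by (subst (2) nths_eq_Nil) force+
  also have "take (Suc j) w = take j w @ [w ! j]" using j by (simp add: take_Suc_conv_app_nth)
  also have "nths \<dots> I = nths (take j w) I @ [w ! j]"
    using j by (simp add: nths_append)
  finally have "nths w I = nths (take j w) I @ [w ! j]" .
  thus "nths w I \<noteq> []" "last (nths w I) = w ! Max I" by (simp_all add: j_def)
qed

lemma nths_insert_greater:
  assumes "J \<subseteq> {0..<i}" "i < length w"
  shows "nths w (insert i J) = nths w J @ [w ! i]"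
proof -
  define p q c where "p = take i w" and "q = drop (Suc i) w" and "c = w ! i"
  have w: "w = p @ c # q" and lp: "length p = i"
    using assms(2) by (simp_all add: p_def q_def c_def id_take_nth_drop)
  have "nths q {j. Suc (j + i) \<in> J} = []" "nths q {j. Suc (j + i) \<in> insert i J} = []"
    using assms by (force intro!: nths_eq_Nil)+
  moreover have "nths p (insert i J) = nths p J"
    unfolding nths_def using lp
    by (intro arg_cong[of _ _ "map fst"] filter_cong) (auto dest: set_zip_rightD)
  moreover have "i \<notin> J" using assms by auto
  ultimately have "nths (p @ c # q) (insert i J) = nths (p @ c # q) J @ [c]"
    using lp by (simp add: nths_append nths_Cons)
  thus ?thesis by (simp only: w[symmetric] c_def[symmetric])
qed

lemma orient_cases_along: "x = y \<or> ordlt Up x y \<or> ordlt Down x y"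
  by (auto simp: ordlt_def ordle_def)

lemma rollercoaster_snoc:
  assumes "s \<noteq> []"
  shows "plateau_rollercoaster k h d (s @ [y]) \<longleftrightarrow>
     last s = y \<and> plateau_rollercoaster k h d s \<or>
     ordlt d (last s) y \<and> plateau_rollercoaster k (max 1 (h - 1)) d s \<or>
     ordlt (opp d) (last s) y \<and> h \<le> 1 \<and> plateau_rollercoaster k (max 1 (k - 1)) (opp d) s"
proof -
  consider (same) "last s = y" | (along) "ordlt d (last s) y" | (against) "ordlt (opp d) (last s) y"
    using orient_cases_along[of "last s" y] by (cases d) auto
  thus ?thesis
  proof cases
    case same
    thus ?thesis using rollercoaster_snoc_same[OF assms, of k h d] by (auto simp: ordlt_def)
  next
    case along
    hence "last s \<noteq> y" "\<not> ordlt (opp d) (last s) y"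
      using ordlt_imp_le by (auto simp: ordlt_def)
    thus ?thesis using along rollercoaster_snoc_along[OF assms along] by auto
  next
    case against
    hence "last s \<noteq> y" "\<not> ordlt d (last s) y"
      using ordlt_imp_le by (auto simp: ordlt_def)
    thus ?thesis using against rollercoaster_snoc_against[OF assms against, of k h] by auto
  qed
qed

section \<open>Counting position sets by their greatest element\<close>

definition rc_sets :: "nat list \<Rightarrow> nat \<Rightarrow> nat \<Rightarrow> orient \<Rightarrow> nat \<Rightarrow> nat set set" where
  "rc_sets w k i d h = {I. I \<subseteq> {0..<length w} \<and> I \<noteq> {} \<and> Max I = i \<and>
              plateau_rollercoaster k h d (nths w I)}"

lemma rc_table_eq_card: "rc_table w k i d h = card (rc_sets w k i d h)"
  by (simp add: rc_table_def rc_sets_def)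

lemma finite_rc_sets [simp]: "finite (rc_sets w k i d h)"
  by (rule finite_subset[of _ "Pow {0..<length w}"]) (auto simp: rc_sets_def)

lemma rc_sets_below:
  assumes "J \<in> rc_sets w k j d h" "j < i"
  shows "J \<subseteq> {0..<i} \<and> J \<noteq> {}"
proof -
  have "finite J" "J \<noteq> {}" "Max J = j" using assms finite_subset by (auto simp: rc_sets_def)
  hence "x < i" if "x \<in> J" for x using Max_ge[of J x] that assms(2) by simp
  thus ?thesis using \<open>J \<noteq> {}\<close> by auto
qed

text \<open>Removing the greatest position \<open>i\<close> leaves either nothing or a set ending at
  some earlier \<open>j\<close>; the comparison of \<open>w ! j\<close> with \<open>w ! i\<close>
  selects the case of \<open>rollercoaster_snoc\<close>.\<close>

lemma rc_sets_rec:
  assumes i: "i < length w"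
  shows "rc_sets w k i d h =
     (if h \<le> 1 then {{i}} else {}) \<union>
     insert i ` ((\<Union>j\<in>{j. j < i \<and> w ! j = w ! i}. rc_sets w k j d h) \<union>
       (\<Union>j\<in>{j. j < i \<and> ordlt d (w ! j) (w ! i)}. rc_sets w k j d (max 1 (h - 1))) \<union>
       (\<Union>j\<in>{j. j < i \<and> ordlt (opp d) (w ! j) (w ! i) \<and> h \<le> 1}. rc_sets w k j (opp d) (max 1 (k - 1))))"
    (is "_ = ?A \<union> insert i ` ?B")
proof -
  have B: "J \<in> ?B \<longleftrightarrow> J \<subseteq> {0..<i} \<and> J \<noteq> {} \<and> plateau_rollercoaster k h d (nths w (insert i J))" for J
  proof (cases "J \<subseteq> {0..<i} \<and> J \<noteq> {}")
    case True
    hence M: "J \<subseteq> {0..<length w}" "J \<noteq> {}" "Max J < i"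
      using i finite_subset[of J "{0..<i}"] Max_in[of J] by auto
    show ?thesis
      unfolding nths_insert_greater[OF conjunct1[OF True] i]
        rollercoaster_snoc[OF nths_snoc_Max(1)[OF M(1,2)]] nths_snoc_Max(2)[OF M(1,2)]
      using True M by (auto simp: rc_sets_def)
  next
    case False
    hence "J \<notin> ?B" using rc_sets_below by blast
    thus ?thesis using False by blast
  qed
  have "nths w {i} = [w ! i]" using nths_insert_greater[of "{}" i w] i by simp
  hence single: "plateau_rollercoaster k h d (nths w {i}) \<longleftrightarrow> h \<le> 1"
    by (simp add: rollercoaster_singleton)
  show ?thesis
  proof (intro equalityI subsetI)
    fix I assume I: "I \<in> rc_sets w k i d h"
    hence fin: "finite I" "I \<noteq> {}" and Mx: "Max I = i" using finite_subset by (auto simp: rc_sets_def)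
    hence "i \<in> I" using Max_in by blast
    define J where "J = I - {i}"
    have IJ: "I = insert i J" using \<open>i \<in> I\<close> by (auto simp: J_def)
    have "x < i" if "x \<in> J" for x using Max_ge[of I x] fin that Mx by (auto simp: J_def)
    hence sub: "J \<subseteq> {0..<i}" by auto
    show "I \<in> ?A \<union> insert i ` ?B"
    proof (cases "J = {}")
      case True
      thus ?thesis using I IJ single by (auto simp: rc_sets_def)
    next
      case False
      hence "J \<in> ?B" using I IJ sub unfolding B by (simp add: rc_sets_def)
      thus ?thesis using IJ by blast
    qed
  next
    fix I assume "I \<in> ?A \<union> insert i ` ?B"
    then consider "I = {i}" "h \<le> 1" | J where "I = insert i J" "J \<in> ?B" by (auto split: if_splits)
    thus "I \<in> rc_sets w k i d h"
    proof cases
      case 1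
      thus ?thesis using single i by (simp add: rc_sets_def)
    next
      case 2
      hence J: "J \<subseteq> {0..<i}" "J \<noteq> {}" "plateau_rollercoaster k h d (nths w (insert i J))"
        unfolding B by blast+
      have "finite J" using J finite_subset by blast
      hence "Max (insert i J) = i" using J by (intro Max_eqI) auto
      thus ?thesis using 2 J i by (auto simp: rc_sets_def)
    qed
  qed
qed

lemma card_UN_rc_sets:
  assumes "finite A"
  shows "card (\<Union>j\<in>A. rc_sets w k j d h) = (\<Sum>j\<in>A. rc_table w k j d h)"
  unfolding rc_table_eq_card
  by (rule card_UN_disjoint[OF assms]) (auto simp: rc_sets_def)

text \<open>The maximum of a position set determines its last letter, so the three unions are
  disjoint: that letter equals \<open>w ! i\<close>, or precedes it strictly in direction
  \<open>d\<close>, or in direction \<open>opp d\<close>. Inserting \<open>i\<close> is injective on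
  sets below \<open>i\<close>, so cardinalities add up.\<close>

lemma rc_table_rec:
  assumes i: "i < length w"
  shows "rc_table w k i d h =
     (if h \<le> 1 then 1 else 0) +
     (\<Sum>j | j < i \<and> w ! j = w ! i. rc_table w k j d h) +
     (\<Sum>j | j < i \<and> ordlt d (w ! j) (w ! i). rc_table w k j d (max 1 (h - 1))) +
     (if h \<le> 1 then \<Sum>j | j < i \<and> ordlt (opp d) (w ! j) (w ! i). rc_table w k j (opp d) (max 1 (k - 1))
      else 0)"
proof -
  let ?E = "{j. j < i \<and> w ! j = w ! i}"
  let ?A = "{j. j < i \<and> ordlt d (w ! j) (w ! i)}"
  let ?O = "{j. j < i \<and> ordlt (opp d) (w ! j) (w ! i) \<and> h \<le> 1}"
  define X where "X = (\<Union>j\<in>?E. rc_sets w k j d h)"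
  define Y where "Y = (\<Union>j\<in>?A. rc_sets w k j d (max 1 (h - 1)))"
  define Z where "Z = (\<Union>j\<in>?O. rc_sets w k j (opp d) (max 1 (k - 1)))"
  define S where "S = (if h \<le> 1 then {{i}} else {})"
  have XYZ: "J \<subseteq> {0..<i} \<and> J \<noteq> {}" if "J \<in> X \<union> Y \<union> Z" for J
    using that rc_sets_below unfolding X_def Y_def Z_def by blast
  have fin: "finite X" "finite Y" "finite Z" by (auto simp: X_def Y_def Z_def)
  have MX: "w ! Max J = w ! i" if "J \<in> X" for J using that by (auto simp: X_def rc_sets_def)
  have MY: "ordlt d (w ! Max J) (w ! i)" if "J \<in> Y" for J using that by (auto simp: Y_def rc_sets_def)
  have MZ: "ordlt (opp d) (w ! Max J) (w ! i)" if "J \<in> Z" for J using that by (auto simp: Z_def rc_sets_def)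
  have "X \<inter> Y = {}" "(X \<union> Y) \<inter> Z = {}"
    using MX MY MZ ordlt_imp_le[of d] by (fastforce simp: ordlt_def)+
  hence "card (X \<union> Y \<union> Z) = card X + card Y + card Z"
    using fin by (simp add: card_Un_disjoint)
  moreover have "inj_on (insert i) (X \<union> Y \<union> Z)"
  proof (rule inj_onI)
    fix I J assume *: "I \<in> X \<union> Y \<union> Z" "J \<in> X \<union> Y \<union> Z" "insert i I = insert i J"
    have "i \<notin> I" "i \<notin> J" using XYZ[OF *(1)] XYZ[OF *(2)] by auto
    thus "I = J" using *(3) by (metis insert_ident)
  qed
  ultimately have "card (insert i ` (X \<union> Y \<union> Z)) = card X + card Y + card Z"
    by (simp add: card_image)
  moreover have "insert i J \<noteq> {i}" if J: "J \<in> X \<union> Y \<union> Z" for J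
  proof
    assume *: "insert i J = {i}"
    obtain x where "x \<in> J" "x < i" using XYZ[OF J] by fastforce
    thus False using * by blast
  qed
  hence "S \<inter> insert i ` (X \<union> Y \<union> Z) = {}"
    unfolding S_def by (simp add: image_iff)
  moreover have "finite S" by (simp add: S_def)
  moreover have "rc_sets w k i d h = S \<union> insert i ` (X \<union> Y \<union> Z)"
    unfolding X_def Y_def Z_def S_def by (rule rc_sets_rec[OF i])
  ultimately have "rc_table w k i d h = card S + card X + card Y + card Z"
    using fin by (simp add: rc_table_eq_card card_Un_disjoint)
  moreover have "card X = (\<Sum>j\<in>?E. rc_table w k j d h)"
    "card Y = (\<Sum>j\<in>?A. rc_table w k j d (max 1 (h - 1)))"
    "card Z = (\<Sum>j\<in>?O. rc_table w k j (opp d) (max 1 (k - 1)))"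
    unfolding X_def Y_def Z_def by (simp_all add: card_UN_rc_sets)
  ultimately show ?thesis by (simp add: S_def)
qed

subsection \<open>Structured programs\<close>

datatype com =
    Basic "instr list"
  | Seq com com  (infixr ";;" 60)
  | WhileGt nat nat com
  | IfGt nat nat com

fun csize :: "com \<Rightarrow> nat" where
  "csize (Basic is) = length is"
| "csize (c1 ;; c2) = csize c1 + csize c2"
| "csize (WhileGt a b c) = csize c + 2"
| "csize (IfGt a b c) = csize c + 1"

text \<open>Jump targets are absolute, hence the start address \<open>p\<close>. The instruction
  \<open>JLe a a p\<close> compares a cell with itself and so acts as an unconditional jump.\<close>

fun compile :: "nat \<Rightarrow> com \<Rightarrow> instr list" where
  "compile p (Basic is) = is"
| "compile p (c1 ;; c2) = compile p c1 @ compile (p + csize c1) c2"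
| "compile p (WhileGt a b c) = JLe a b (p + csize c + 2) # compile (Suc p) c @ [JLe a a p]"
| "compile p (IfGt a b c) = JLe a b (p + csize c + 1) # compile (Suc p) c"

lemma length_compile [simp]: "length (compile p c) = csize c"
  by (induction c arbitrary: p) auto

section \<open>Effects of straight-line code and a timed judgement for commands\<close>

fun effect :: "instr \<Rightarrow> mem \<Rightarrow> mem" where
  "effect (LoadC a c) m = m(a := c)"
| "effect (Add a b c) m = m(a := m b + m c)"
| "effect (Sub a b c) m = m(a := m b - m c)"
| "effect (LoadI a b) m = m(a := m (m b))"
| "effect (StoreI a b) m = m(m a := m b)"
| "effect _ m = m"

fun straight :: "instr \<Rightarrow> bool" where
  "straight (JLe _ _ _) \<longleftrightarrow> False"
| "straight Halt \<longleftrightarrow> False"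
| "straight _ \<longleftrightarrow> True"

text \<open>A total-correctness triple with a step bound, for one start memory. Quantifying over the
  surrounding code makes it independent of the place of the command and hence compositional.\<close>

definition runs :: "com \<Rightarrow> mem \<Rightarrow> nat \<Rightarrow> (mem \<Rightarrow> bool) \<Rightarrow> bool" where
  "runs c m T Q \<longleftrightarrow> (\<forall>pre post. \<exists>t\<le>T. \<exists>m'.
     exec (pre @ compile (length pre) c @ post) t (length pre, m) = (length pre + csize c, m') \<and> Q m')"

lemma exec_add: "exec P (t1 + t2) c = exec P t2 (exec P t1 c)"
  by (simp add: exec_def add.commute[of t1] funpow_add)

lemma exec_Suc: "exec P (Suc t) c = exec P t (step P c)"
  by (simp add: exec_def funpow_swap1)

lemma exec_0 [simp]: "exec P 0 c = c"
  by (simp add: exec_def)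

lemma runs_mono:
  assumes "runs c m T Q" "T \<le> T'" "\<And>m'. Q m' \<Longrightarrow> Q' m'"
  shows "runs c m T' Q'"
  using assms unfolding runs_def by (meson le_trans)

lemma step_straight:
  assumes "straight i"
  shows "step (pre @ i # post) (length pre, m) = (Suc (length pre), effect i m)"
  using assms by (cases i) (auto simp: nth_append)

lemma exec_straight:
  "list_all straight is \<Longrightarrow>
     exec (pre @ is @ post) (length is) (length pre, m) = (length pre + length is, fold effect is m)"
proof (induction "is" arbitrary: pre m)
  case (Cons i "is")
  have "exec (pre @ (i # is) @ post) (length (i # is)) (length pre, m) =
      exec ((pre @ [i]) @ is @ post) (length is) (length (pre @ [i]), effect i m)"
    using Cons.prems by (simp add: exec_Suc step_straight del: step.simps)
  also have "\<dots> = (length (pre @ [i]) + length is, fold effect is (effect i m))"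
    by (rule Cons.IH) (use Cons.prems in simp)
  finally show ?case by simp
qed simp

lemma runs_Basic:
  assumes "list_all straight is" "Q (fold effect is m)" "length is \<le> T"
  shows "runs (Basic is) m T Q"
  unfolding runs_def using exec_straight[OF assms(1)] assms by fastforce

lemma runs_Seq:
  assumes "runs c1 m T1 (\<lambda>m'. runs c2 m' T2 Q)"
  shows "runs (c1 ;; c2) m (T1 + T2) Q"
  unfolding runs_def
proof (intro allI)
  fix pre post :: "instr list"
  let ?P = "pre @ compile (length pre) (c1 ;; c2) @ post"
  from assms[unfolded runs_def[of c1], rule_format, of pre "compile (length pre + csize c1) c2 @ post"]
  obtain t1 m1 where 1: "t1 \<le> T1" "runs c2 m1 T2 Q"
    "exec ?P t1 (length pre, m) = (length pre + csize c1, m1)"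
    by auto
  from 1(2)[unfolded runs_def, rule_format, of "pre @ compile (length pre) c1" post]
  obtain t2 m2 where 2: "t2 \<le> T2" "Q m2"
    "exec ?P t2 (length pre + csize c1, m1) = (length pre + csize c1 + csize c2, m2)"
    by (auto simp: add.assoc)
  show "\<exists>t\<le>T1 + T2. \<exists>m'. exec ?P t (length pre, m) = (length pre + csize (c1 ;; c2), m') \<and> Q m'"
    using 1 2 by (intro exI[of _ "t1 + t2"] exI[of _ m2] conjI) (auto simp: exec_add add.assoc)
qed

lemma runs_SeqI:
  assumes "runs c1 m T1 R" "\<And>m'. R m' \<Longrightarrow> runs c2 m' T2 Q" "T1 + T2 \<le> T"
  shows "runs (c1 ;; c2) m T Q"
  by (rule runs_mono[OF runs_Seq[OF runs_mono[OF assms(1) order_refl]] assms(3)]) (use assms(2) in auto)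

lemma runs_If:
  assumes "m b < m a \<Longrightarrow> runs c m T Q" "m a \<le> m b \<Longrightarrow> Q m"
  shows "runs (IfGt a b c) m (Suc T) Q"
  unfolding runs_def
proof (intro allI)
  fix pre post :: "instr list"
  let ?P = "pre @ compile (length pre) (IfGt a b c) @ post"
  show "\<exists>t\<le>Suc T. \<exists>m'. exec ?P t (length pre, m) = (length pre + csize (IfGt a b c), m') \<and> Q m'"
  proof (cases "m a \<le> m b")
    case True
    thus ?thesis using assms(2) by (intro exI[of _ 1] conjI exI[of _ m]) (auto simp: exec_Suc)
  next
    case False
    hence "runs c m T Q" using assms by simp
    from this[unfolded runs_def, rule_format, of "pre @ [JLe a b (length pre + csize c + 1)]" post]
    obtain t m' where "t \<le> T" "Q m'" "exec ?P t (Suc (length pre), m) = (Suc (length pre + csize c), m')"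
      by auto
    thus ?thesis using False
      by (intro exI[of _ "Suc t"] conjI exI[of _ m']) (auto simp: exec_Suc nth_append)
  qed
qed

text \<open>The invariant is indexed by the number of completed rounds. A round costs its body, one
  test and one jump back; the final failing test accounts for the additional step.\<close>

lemma runs_While:
  assumes "\<And>j m. j < N \<Longrightarrow> I j m \<Longrightarrow> m b < m a \<and> runs c m T (I (Suc j))"
    and "\<And>m. I N m \<Longrightarrow> m a \<le> m b"
    and "I 0 m"
  shows "runs (WhileGt a b c) m (N * (T + 2) + 1) (I N)"
  unfolding runs_def
proof (intro allI)
  fix pre post :: "instr list"
  let ?p = "length pre"
  let ?P = "pre @ compile ?p (WhileGt a b c) @ post"
  have "\<exists>t \<le> (N - j) * (T + 2) + 1. \<exists>m'. exec ?P t (?p, m) = (?p + csize (WhileGt a b c), m') \<and> I N m'"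
    if "j \<le> N" "I j m" for j m
    using that
  proof (induction arbitrary: m rule: inc_induct)
    case base
    thus ?case using assms(2) by (intro exI[of _ 1] conjI exI[of _ m]) (auto simp: exec_Suc)
  next
    case (step j)
    hence 1: "m b < m a" "runs c m T (I (Suc j))" using assms(1) by auto
    from 1(2)[unfolded runs_def, rule_format, of "pre @ [JLe a b (length pre + csize c + 2)]" "JLe a a ?p # post"]
    obtain t m' where 2: "t \<le> T" "I (Suc j) m'" "exec ?P t (Suc ?p, m) = (Suc (?p + csize c), m')"
      by auto
    from step.IH[OF 2(2)] obtain t' m'' where 3: "t' \<le> (N - Suc j) * (T + 2) + 1" "I N m''"
      "exec ?P t' (?p, m') = (?p + csize (WhileGt a b c), m'')" by auto
    have 4: "exec ?P (Suc t) (?p, m) = (Suc (?p + csize c), m')"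
      using 1 2 by (simp add: exec_Suc nth_append)
    have 5: "exec ?P 1 (Suc (?p + csize c), m') = (?p, m')"
      by (simp add: exec_Suc nth_append)
    have "exec ?P (Suc t + 1 + t') (?p, m) = (?p + csize (WhileGt a b c), m'')"
      unfolding exec_add 4 5 3(3) ..
    moreover have "Suc t + 1 + t' \<le> (N - j) * (T + 2) + 1"
    proof -
      have "N - j = Suc (N - Suc j)" using step by simp
      thus ?thesis using 2 3 by simp
    qed
    ultimately show ?case using 3(2) by blast
  qed
  from this[of 0 m] show "\<exists>t\<le>N * (T + 2) + 1. \<exists>m'. exec ?P t (?p, m) = (?p + csize (WhileGt a b c), m') \<and> I N m'"
    using assms(3) by simp
qed

subsection \<open>Updating the table at one position\<close>

text \<open>Cells below 22 are registers: 0 the displacement of the table, 1 \<open>k\<close>, 2 the constant one,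
  3 \<open>2 k\<close>, 4 the array \<open>S\<close> (\<open>k\<close> cells for \<open>Up\<close>, then \<open>k\<close> for \<open>Down\<close>, per letter), 5 the next table entry,
  6 and 7 the current position and the end of the copied word, 8 the block of \<open>S\<close> for the current
  letter, 9 the end of the blocks in use, 10 the term added at \<open>g = 0\<close>, 11 the block at which a sum
  starts, 12 the part of \<open>S\<close> being updated, 13 the bound of a loop, 14 an accumulator, 15 to 17 the
  running address, a scratch cell and \<open>g\<close>, 18 \<open>k - 2\<close>, 19 and 20 source and target of a copy.\<close>

text \<open>Deciding these disequations by arithmetic inside \<open>simp\<close> is slow in the presence of further
  disequations, so they are kept as rewrite rules.\<close>

lemma high_neq:
  assumes "22 \<le> (a :: nat)"
  shows "a \<noteq> 0" "0 \<noteq> a"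
    "a \<noteq> 1" "1 \<noteq> a"
    "a \<noteq> Suc 0" "Suc 0 \<noteq> a"
    "a \<noteq> 2" "2 \<noteq> a"
    "a \<noteq> 3" "3 \<noteq> a"
    "a \<noteq> 4" "4 \<noteq> a"
    "a \<noteq> 5" "5 \<noteq> a"
    "a \<noteq> 6" "6 \<noteq> a"
    "a \<noteq> 7" "7 \<noteq> a"
    "a \<noteq> 8" "8 \<noteq> a"
    "a \<noteq> 9" "9 \<noteq> a"
    "a \<noteq> 10" "10 \<noteq> a"
    "a \<noteq> 11" "11 \<noteq> a"
    "a \<noteq> 12" "12 \<noteq> a"
    "a \<noteq> 13" "13 \<noteq> a"
    "a \<noteq> 14" "14 \<noteq> a"
    "a \<noteq> 15" "15 \<noteq> a"
    "a \<noteq> 16" "16 \<noteq> a"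
    "a \<noteq> 17" "17 \<noteq> a"
    "a \<noteq> 18" "18 \<noteq> a"
    "a \<noteq> 19" "19 \<noteq> a"
    "a \<noteq> 20" "20 \<noteq> a"
    "a \<noteq> 21" "21 \<noteq> a"
  using assms by simp_all

section \<open>Loops for summing and copying\<close>

definition sum_loop :: com where
  "sum_loop = WhileGt 13 15 (Basic [LoadI 16 15, Add 14 14 16, Add 15 15 3])"

text \<open>Describing \<open>N\<close> by the addresses below the bound avoids dividing by the
  stride in cell 3. The lower bound 22 keeps the summands away from the cells that the loop
  changes.\<close>

lemma runs_sum_loop:
  assumes "22 \<le> m 15" and N: "\<And>j. m 15 + j * m 3 < m 13 \<longleftrightarrow> j < N"
  shows "runs sum_loop m (5 * N + 1)
    (\<lambda>m'. m' 14 = m 14 + (\<Sum>j<N. m (m 15 + j * m 3)) \<and> (\<forall>x. x \<notin> {14, 15, 16} \<longrightarrow> m' x = m x))"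
proof -
  let ?I = "\<lambda>j m'. m' 14 = m 14 + (\<Sum>i<j. m (m 15 + i * m 3)) \<and> m' 15 = m 15 + j * m 3 \<and>
     (\<forall>x. x \<notin> {14, 15, 16} \<longrightarrow> m' x = m x)"
  have "runs sum_loop m (N * (3 + 2) + 1) (?I N)"
    unfolding sum_loop_def
  proof (rule runs_While)
    fix j m' assume j: "j < N" and I: "?I j m'"
    show "m' 15 < m' 13 \<and> runs (Basic [LoadI 16 15, Add 14 14 16, Add 15 15 3]) m' 3 (?I (Suc j))"
      using I N[of j] j assms(1) by (auto intro!: runs_Basic)
  qed (use N[of N] in auto)
  thus ?thesis by (rule runs_mono) auto
qed

definition copy_loop :: com where
  "copy_loop = WhileGt 13 19 (Basic [LoadI 16 19, StoreI 20 16, Add 19 19 2, Add 20 20 2])"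

text \<open>Copying proceeds upwards. A target at or below the source overwrites only source cells
  that were already read, and a target behind the whole source overwrites none.\<close>

lemma runs_copy_loop:
  assumes "m 2 = 1" "22 \<le> m 19" "22 \<le> m 20" and N: "N = m 13 - m 19"
    and disj: "m 19 + N \<le> m 20 \<or> m 20 \<le> m 19"
  shows "runs copy_loop m (6 * N + 1)
    (\<lambda>m'. (\<forall>i<N. m' (m 20 + i) = m (m 19 + i)) \<and>
       (\<forall>x. x \<notin> {16, 19, 20} \<longrightarrow> \<not> (m 20 \<le> x \<and> x < m 20 + N) \<longrightarrow> m' x = m x))"
proof -
  let ?I = "\<lambda>j m'. m' 19 = m 19 + j \<and> m' 20 = m 20 + j \<and> (\<forall>i<j. m' (m 20 + i) = m (m 19 + i)) \<and>
     (\<forall>x. x \<notin> {16, 19, 20} \<longrightarrow> \<not> (m 20 \<le> x \<and> x < m 20 + j) \<longrightarrow> m' x = m x)"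
  have "runs copy_loop m (N * (4 + 2) + 1) (?I N)"
    unfolding copy_loop_def
  proof (rule runs_While)
    fix j m' assume j: "j < N" and I: "?I j m'"
    have fr: "m' x = m x" if "x \<notin> {16, 19, 20}" "\<not> (m 20 \<le> x \<and> x < m 20 + j)" for x
      using I that by blast
    have r: "m' 2 = 1" "m' 13 = m 13" using fr assms(1,3) by simp_all
    define A where "A = m 20 + j"
    have A: "22 \<le> A" "22 \<le> m 19 + j" using assms(2,3) by (simp_all add: A_def)
    note ne = high_neq[OF A(1)] high_neq[OF A(2)]
    have val: "m' (m 19 + j) = m (m 19 + j)"
    proof (rule fr)
      show "m 19 + j \<notin> {16, 19, 20}" using ne by blast
    qed (use disj j in linarith)
    have r': "m' 19 = m 19 + j" "m' 20 = A" using I by (simp_all add: A_def)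
    define M where "M = fold effect [LoadI 16 19, StoreI 20 16, Add 19 19 2, Add 20 20 2] m'"
    have M: "M 19 = m 19 + Suc j" "M 20 = Suc A" "M A = m (m 19 + j)"
      unfolding M_def by (simp_all add: ne r r' val)
    have Mx: "M x = m' x" if "x \<notin> {16, 19, 20, A}" for x
      using that unfolding M_def by (simp add: ne r r')
    have "M (m 20 + i) = m (m 19 + i)" if "i < Suc j" for i
    proof (cases "i = j")
      case False
      have "22 \<le> m 20 + i" using assms(3) by simp
      from high_neq[OF this] have "M (m 20 + i) = m' (m 20 + i)"
        using False by (intro Mx) (simp add: A_def)
      thus ?thesis using I False that by simp
    qed (use M in \<open>simp add: A_def\<close>)
    moreover have "M x = m x" if "x \<notin> {16, 19, 20}" "\<not> (m 20 \<le> x \<and> x < m 20 + Suc j)" for x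
    proof -
      have "x \<noteq> A" using that(2) by (auto simp: A_def)
      hence "M x = m' x" using that(1) by (intro Mx) blast
      also have "m' x = m x" using that by (intro fr) auto
      finally show ?thesis .
    qed
    ultimately have "?I (Suc j) M" using M by (simp add: A_def)
    hence "runs (Basic [LoadI 16 19, StoreI 20 16, Add 19 19 2, Add 20 20 2]) m' 4 (?I (Suc j))"
      unfolding M_def by - (rule runs_Basic, simp, assumption, simp)
    thus "m' 19 < m' 13 \<and>
        runs (Basic [LoadI 16 19, StoreI 20 16, Add 19 19 2, Add 20 20 2]) m' 4 (?I (Suc j))"
      using N j r r' by simp
  qed (use N assms(2,3) in auto)
  thus ?thesis by (rule runs_mono) auto
qed

text \<open>Subtraction stops at zero, so for \<open>g = 0\<close> the sum reads column 0, as the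
  raised index \<open>max 1 (h - 1)\<close> demands. Cell 10 is cleared after its first use, so its
  term enters at \<open>g = 0\<close> only.\<close>

definition row_cell :: com where
  "row_cell =
     Basic [Sub 15 17 2, Add 15 15 11, LoadC 14 0, Add 14 14 10, LoadC 10 0] ;;
     sum_loop ;;
     Basic [Add 15 12 17, LoadI 16 15, Add 14 14 16, Add 16 16 14, StoreI 15 16, StoreI 5 14,
       Add 5 5 2, Add 17 17 2]"

definition row :: com where
  "row = Basic [LoadC 17 0] ;; WhileGt 1 17 row_cell"

lemma runs_row_cell:
  assumes m: "m 2 = 1" "22 \<le> m 11" "22 \<le> m 5" "22 \<le> m 12" "m 5 < m 12"
    and N: "\<And>j. m 11 + (m 17 - 1) + j * m 3 < m 13 \<longleftrightarrow> j < N"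
    and v: "v = m 10 + (\<Sum>j<N. m (m 11 + (m 17 - 1) + j * m 3)) + m (m 12 + m 17)"
  shows "runs row_cell m (5 * N + 14)
    (\<lambda>m'. m' 17 = Suc (m 17) \<and> m' 5 = Suc (m 5) \<and> m' 10 = 0 \<and>
       m' (m 12 + m 17) = m (m 12 + m 17) + v \<and> m' (m 5) = v \<and>
       (\<forall>x. x \<notin> {5, 10, 14, 15, 16, 17, m 5, m 12 + m 17} \<longrightarrow> m' x = m x))"
  unfolding row_cell_def
proof (rule runs_SeqI[OF runs_Basic[OF _ refl order_refl]])
  fix m1 assume "m1 = fold effect [Sub 15 17 2, Add 15 15 11, LoadC 14 0, Add 14 14 10, LoadC 10 0] m"
  hence m1: "m1 = m(15 := m 11 + (m 17 - 1), 14 := m 10, 10 := 0)"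
    using m by (auto simp: fun_eq_iff)
  show "runs (sum_loop ;;
     Basic [Add 15 12 17, LoadI 16 15, Add 14 14 16, Add 16 16 14, StoreI 15 16, StoreI 5 14,
       Add 5 5 2, Add 17 17 2]) m1 (5 * N + 9)
    (\<lambda>m'. m' 17 = Suc (m 17) \<and> m' 5 = Suc (m 5) \<and> m' 10 = 0 \<and>
       m' (m 12 + m 17) = m (m 12 + m 17) + v \<and> m' (m 5) = v \<and>
       (\<forall>x. x \<notin> {5, 10, 14, 15, 16, 17, m 5, m 12 + m 17} \<longrightarrow> m' x = m x))"
  proof (rule runs_SeqI[OF runs_sum_loop[where N = N]])
    show "22 \<le> m1 15" using m by (simp add: m1)
    show "(m1 15 + j * m1 3 < m1 13) = (j < N)" for j using N by (simp add: m1)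
  next
    fix m2 assume m2: "m2 14 = m1 14 + (\<Sum>j<N. m1 (m1 15 + j * m1 3)) \<and>
      (\<forall>x. x \<notin> {14, 15, 16} \<longrightarrow> m2 x = m1 x)"
    have "m1 (m1 15 + j * m1 3) = m (m 11 + (m 17 - 1) + j * m 3)" for j
      using m by (simp add: m1)
    hence a: "m2 14 = m 10 + (\<Sum>j<N. m (m 11 + (m 17 - 1) + j * m 3))"
      using m2 by (simp add: m1)
    have r: "m2 x = m x" if "x \<notin> {10, 14, 15, 16}" for x using m2 that by (simp add: m1)
    have r': "m2 10 = 0" using m2 by (simp add: m1)
    define A where "A = m 12 + m 17"
    define T where "T = m 5"
    have AT: "22 \<le> A" "22 \<le> T" "A \<noteq> T" using m by (auto simp: A_def T_def)
    note ne = high_neq[OF AT(1)] high_neq[OF AT(2)]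
    have rr: "m2 12 + m 17 = A" "m2 17 = m 17" "m2 5 = T" "m2 2 = 1" "m2 A = m A"
      using r m ne by (auto simp: A_def T_def)
    have a': "m2 14 + m A = v" using a v by (simp add: A_def)
    define M where "M = fold effect [Add 15 12 17, LoadI 16 15, Add 14 14 16, Add 16 16 14, StoreI 15 16,
       StoreI 5 14, Add 5 5 2, Add 17 17 2] m2"
    have M: "M 17 = Suc (m 17)" "M 5 = Suc T" "M A = m A + v" "M T = v"
      unfolding M_def by (simp_all add: ne AT rr a')
    have Mx: "M x = m2 x" if "x \<notin> {5, 14, 15, 16, 17, T, A}" for x
      using that unfolding M_def by (simp add: ne AT rr a')
    have "M 10 = 0" using Mx[of 10] r' by (simp add: ne)
    moreover have "M x = m x" if "x \<notin> {5, 10, 14, 15, 16, 17, T, A}" for x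
    proof -
      have "M x = m2 x" using that by (intro Mx) blast
      also have "\<dots> = m x" using that by (intro r) blast
      finally show ?thesis .
    qed
    ultimately have "M 17 = Suc (m 17) \<and> M 5 = Suc T \<and> M 10 = 0 \<and> M A = m A + v \<and> M T = v \<and>
       (\<forall>x. x \<notin> {5, 10, 14, 15, 16, 17, T, A} \<longrightarrow> M x = m x)"
      using M by blast
    thus "runs (Basic [Add 15 12 17, LoadI 16 15, Add 14 14 16, Add 16 16 14, StoreI 15 16, StoreI 5 14,
       Add 5 5 2, Add 17 17 2]) m2 8
     (\<lambda>m'. m' 17 = Suc (m 17) \<and> m' 5 = Suc (m 5) \<and> m' 10 = 0 \<and>
       m' (m 12 + m 17) = m (m 12 + m 17) + v \<and> m' (m 5) = v \<and>
       (\<forall>x. x \<notin> {5, 10, 14, 15, 16, 17, m 5, m 12 + m 17} \<longrightarrow> m' x = m x))"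
      unfolding A_def[symmetric] T_def[symmetric] M_def
      by - (rule runs_Basic, simp, assumption, simp)
  qed simp
qed auto

text \<open>By \<open>disj\<close> the summands lie outside the table row and outside the block of
  \<open>S\<close> being written. Hence each column still sees the sums belonging to earlier
  positions, although column \<open>g - 1\<close> of the row has just been updated.\<close>

lemma runs_row:
  assumes m: "m 2 = 1" "22 \<le> m 11" "22 \<le> m 5" "m 5 + k \<le> m 12" "m 1 = k"
    and N: "\<And>d j. d < k \<Longrightarrow> m 11 + d + j * m 3 < m 13 \<longleftrightarrow> j < N"
    and disj: "\<And>d j. d < k \<Longrightarrow> j < N \<Longrightarrow>
      m 5 + k \<le> m 11 + d + j * m 3 \<and> (m 11 + d + j * m 3 < m 12 \<or> m 12 + k \<le> m 11 + d + j * m 3)"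
    and v: "\<And>g. g < k \<Longrightarrow> v g = (if g = 0 then m 10 else 0) + (\<Sum>j<N. m (m 11 + (g - 1) + j * m 3)) + m (m 12 + g)"
  shows "runs row m (k * (5 * N + 16) + 2)
    (\<lambda>m'. m' 5 = m 5 + k \<and> (\<forall>g<k. m' (m 12 + g) = m (m 12 + g) + v g \<and> m' (m 5 + g) = v g) \<and>
       (\<forall>x. x \<notin> {5, 10, 14, 15, 16, 17} \<longrightarrow> \<not> (m 5 \<le> x \<and> x < m 5 + k) \<longrightarrow>
          \<not> (m 12 \<le> x \<and> x < m 12 + k) \<longrightarrow> m' x = m x))"
proof -
  let ?I = "\<lambda>g m'. m' 17 = g \<and> m' 5 = m 5 + g \<and> m' 10 = (if g = 0 then m 10 else 0) \<and>
       (\<forall>h<g. m' (m 12 + h) = m (m 12 + h) + v h \<and> m' (m 5 + h) = v h) \<and>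
       (\<forall>x. x \<notin> {5, 10, 14, 15, 16, 17} \<longrightarrow> \<not> (m 5 \<le> x \<and> x < m 5 + g) \<longrightarrow>
          \<not> (m 12 \<le> x \<and> x < m 12 + g) \<longrightarrow> m' x = m x)"
  have cell: "runs row_cell m' (5 * N + 14) (?I (Suc g))" if g: "g < k" and I: "?I g m'" for g m'
  proof -
    have fr': "m' x = m x" if "x \<notin> {5, 10, 14, 15, 16, 17}"
        "\<not> (m 5 \<le> x \<and> x < m 5 + g)" "\<not> (m 12 \<le> x \<and> x < m 12 + g)" for x
      using I that by blast
    have low: "m' x = m x" if "x < 22" "x \<notin> {5, 10, 14, 15, 16, 17}" for x
      using that m by (intro fr') auto
    have r: "m' 2 = 1" "m' 11 = m 11" "m' 12 = m 12" "m' 3 = m 3" "m' 13 = m 13" "m' 1 = k"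
      using low m(1,5) by simp_all
    have d: "g - 1 < k" using g by simp
    have cells: "m' (m 11 + (g - 1) + j * m 3) = m (m 11 + (g - 1) + j * m 3)" (is "m' ?a = m ?a")
      if "j < N" for j
    proof (rule fr')
      have "22 \<le> ?a" using m by simp
      from high_neq[OF this] show "?a \<notin> {5, 10, 14, 15, 16, 17}" by blast
    qed (use disj[OF d that] g in linarith)+
    have cR: "m' (m 12 + g) = m (m 12 + g)" (is "m' ?a = m ?a")
    proof (rule fr')
      have "22 \<le> ?a" using m by simp
      from high_neq[OF this] show "?a \<notin> {5, 10, 14, 15, 16, 17}" by blast
    qed (use m g in linarith)+
    have vg: "v g = m' 10 + (\<Sum>j<N. m' (m' 11 + (m' 17 - 1) + j * m' 3)) + m' (m' 12 + m' 17)"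
      using I cells cR g by (simp add: v r)
    show ?thesis
    proof (rule runs_mono[OF runs_row_cell[OF _ _ _ _ _ _ vg]])
      show "(m' 11 + (m' 17 - 1) + j * m' 3 < m' 13) = (j < N)" for j
        using N[OF d] I by (simp add: r)
    next
      fix m'' assume A: "m'' 17 = Suc (m' 17) \<and> m'' 5 = Suc (m' 5) \<and> m'' 10 = 0 \<and>
         m'' (m' 12 + m' 17) = m' (m' 12 + m' 17) + v g \<and> m'' (m' 5) = v g \<and>
         (\<forall>x. x \<notin> {5, 10, 14, 15, 16, 17, m' 5, m' 12 + m' 17} \<longrightarrow> m'' x = m' x)"
      have B: "m' 17 = g" "m' 5 = m 5 + g" using I by auto
      have fr: "m'' x = m' x" if "x \<notin> {5, 10, 14, 15, 16, 17, m 5 + g, m 12 + g}" for x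
        using A that r B by simp
      have "m'' (m 12 + h) = m (m 12 + h) + v h \<and> m'' (m 5 + h) = v h" if "h < Suc g" for h
      proof (cases "h = g")
        case True
        thus ?thesis using A r B cR by simp
      next
        case False
        hence "h < g" using that by simp
        have "22 \<le> m 12 + h" "22 \<le> m 5 + h" using m by simp_all
        note ne = high_neq[OF this(1)] high_neq[OF this(2)]
        have "m 12 + h \<noteq> m 5 + g" "m 5 + h \<noteq> m 12 + g" using m(4) g \<open>h < g\<close> by linarith+
        hence "m'' (m 12 + h) = m' (m 12 + h)" "m'' (m 5 + h) = m' (m 5 + h)"
          using \<open>h \<noteq> g\<close> ne by (intro fr; simp)+
        thus ?thesis using I \<open>h < g\<close> by simp
      qed
      moreover have "m'' x = m x" if "x \<notin> {5, 10, 14, 15, 16, 17}"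
          "\<not> (m 5 \<le> x \<and> x < m 5 + Suc g)" "\<not> (m 12 \<le> x \<and> x < m 12 + Suc g)" for x
      proof -
        have "x \<noteq> m 5 + g" "x \<noteq> m 12 + g" using that(2,3) by linarith+
        hence "m'' x = m' x" using that(1) by (intro fr) blast
        also have "m' x = m x" using that by (intro fr') auto
        finally show ?thesis .
      qed
      ultimately show "?I (Suc g) m''" using A B by simp
    qed (use I m r g in auto)
  qed
  have "runs row m (1 + (k * ((5 * N + 14) + 2) + 1)) (?I k)"
    unfolding row_def
  proof (rule runs_SeqI[OF runs_Basic[OF _ refl order_refl]])
    fix m1 assume m1: "m1 = fold effect [LoadC 17 0] m"
    show "runs (WhileGt 1 17 row_cell) m1 (k * ((5 * N + 14) + 2) + 1) (?I k)"
    proof (rule runs_While)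
      fix j m' assume j: "j < k" and I: "?I j m'"
      have "m' 1 = k" using I m j by auto
      thus "m' 17 < m' 1 \<and> runs row_cell m' (5 * N + 14) (?I (Suc j))"
        using cell[OF j I] I j by simp
    next
      fix m' assume I: "?I k m'"
      have "m' 1 = k" using I m by auto
      thus "m' 1 \<le> m' 17" using I by simp
    qed (simp add: m1)
  qed auto
  thus ?thesis by (rule runs_mono) auto
qed

text \<open>An address is a block number times \<open>k\<close> plus a column below
  \<open>k\<close>, so comparing it with a block boundary means comparing block numbers. All
  questions of overlap in \<open>S\<close> and in the table are settled this way.\<close>

lemma block_le_iff:
  assumes "d < (k :: nat)"
  shows "A' * k \<le> A * k + d \<longleftrightarrow> A' \<le> A"
proof
  assume "A' \<le> A"
  thus "A' * k \<le> A * k + d" by (simp add: trans_le_add1)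
next
  assume *: "A' * k \<le> A * k + d"
  show "A' \<le> A"
  proof (rule ccontr)
    assume "\<not> A' \<le> A"
    hence "Suc A * k \<le> A' * k" by (intro mult_le_mono1) simp
    thus False using * assms by simp
  qed
qed

lemma block_less_iff:
  assumes "d < (k :: nat)"
  shows "A * k + d < A' * k \<longleftrightarrow> A < A'"
  using block_le_iff[OF assms, of A' A] by (simp add: not_le[symmetric])

text \<open>The common form of both orientations; \<open>2 * a + c\<close> numbers the block of
  letter \<open>a\<close> and orientation \<open>c\<close>. The code \<open>xs\<close> prepares the
  turning-point sum over column \<open>k - 2\<close> of \<open>N1\<close> blocks, with the
  accumulator at one for the single letter. The code \<open>ys\<close> passes its result to cell 10
  and prepares the row. That \<open>x\<close> is outside the letters summed in the row is what makes
  the update in place sound.\<close>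

lemma runs_half:
  assumes m: "m 2 = 1" "m 1 = k" "1 \<le> k" "m 3 = 2 * k" "22 \<le> m 5" "m 5 + k \<le> m 4"
    and c: "c \<le> 1" "c1 \<le> 1"
    and xs: "list_all straight xs" "length xs \<le> 6" "fold effect xs m = m1"
      "m1 14 = 1" "m1 15 = m 4 + ((2 * lo1 + c1) * k + (k - 2))"
      "\<And>x. x \<notin> {13, 14, 15} \<Longrightarrow> m1 x = m x"
      "\<And>j d. d < k \<Longrightarrow> m 4 + ((2 * (lo1 + j) + c1) * k + d) < m1 13 \<longleftrightarrow> j < N1"
    and ys: "list_all straight ys" "length ys \<le> 8"
      "\<And>m'. (\<And>x. x \<notin> {13, 14, 15, 16} \<Longrightarrow> m' x = m x) \<Longrightarrow>
         fold effect ys m' = m'(10 := m' 14, 11 := m 4 + (2 * lo2 + c) * k, 12 := m 4 + (2 * x + c) * k, 13 := L2)"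
    and L2: "\<And>j d. d < k \<Longrightarrow> m 4 + ((2 * (lo2 + j) + c) * k + d) < L2 \<longleftrightarrow> j < N2"
    and x: "x \<notin> {lo2..<lo2 + N2}"
    and v: "\<And>g. g < k \<Longrightarrow> v g = (if g = 0 then 1 + (\<Sum>j<N1. m (m 4 + ((2 * (lo1 + j) + c1) * k + (k - 2)))) else 0) +
       (\<Sum>j<N2. m (m 4 + ((2 * (lo2 + j) + c) * k + (g - 1)))) + m (m 4 + ((2 * x + c) * k + g))"
  shows "runs (Basic xs ;; sum_loop ;; Basic ys ;; row) m (5 * N1 + k * (5 * N2 + 16) + 17)
    (\<lambda>m'. m' 5 = m 5 + k \<and> (\<forall>g<k. m' (m 5 + g) = v g) \<and>
      (\<forall>a c' g. g < k \<longrightarrow> c' \<le> 1 \<longrightarrow> m' (m 4 + ((2 * a + c') * k + g)) =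
          m (m 4 + ((2 * a + c') * k + g)) + (if a = x \<and> c' = c then v g else 0)) \<and>
      (\<forall>z. z \<notin> {5, 10, 11, 12, 13, 14, 15, 16, 17} \<longrightarrow> \<not> (m 5 \<le> z \<and> z < m 5 + k) \<longrightarrow> z < m 4 \<longrightarrow> m' z = m z))"
    (is "runs _ _ _ ?Q")
proof (rule runs_SeqI[OF runs_Basic[OF xs(1) refl xs(2)]])
  have SB: "22 \<le> m 4 + z" for z using m by simp
  have m1: "m1 4 = m 4" "m1 3 = 2 * k" using xs(6) m by simp_all
  have m1h: "m1 (m 4 + z) = m (m 4 + z)" for z
    using xs(6) high_neq[OF SB[of z]] by simp
  have row1: "m 4 + ((2 * lo1 + c1) * k + d) + j * (2 * k) = m 4 + ((2 * (lo1 + j) + c1) * k + d)" for j d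
    by (simp add: algebra_simps)
  have row2: "m 4 + (2 * lo2 + c) * k + d + j * (2 * k) = m 4 + ((2 * (lo2 + j) + c) * k + d)" for j d
    by (simp add: algebra_simps)
  fix m1' assume "m1' = fold effect xs m"
  hence [simp]: "m1' = m1" using xs(3) by simp
  show "runs (sum_loop ;; Basic ys ;; row) m1' (5 * N1 + k * (5 * N2 + 16) + 11) ?Q"
    unfolding \<open>m1' = m1\<close>
  proof (rule runs_SeqI[OF runs_sum_loop[where N = N1]])
    show "22 \<le> m1 15" using xs(5) SB by simp
    show "(m1 15 + j * m1 3 < m1 13) = (j < N1)" for j
      unfolding xs(5) m1 row1 by (rule xs(7)) (use m in simp)
  next
    fix m2 assume m2: "m2 14 = m1 14 + (\<Sum>j<N1. m1 (m1 15 + j * m1 3)) \<and>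
      (\<forall>x. x \<notin> {14, 15, 16} \<longrightarrow> m2 x = m1 x)"
    hence s1: "m2 14 = 1 + (\<Sum>j<N1. m (m 4 + ((2 * (lo1 + j) + c1) * k + (k - 2))))"
      unfolding xs(4,5) m1 row1 m1h by simp
    have m2m: "m2 x = m x" if "x \<notin> {13, 14, 15, 16}" for x using m2 xs(6) that by simp
    show "runs (Basic ys ;; row) m2 (k * (5 * N2 + 16) + 10) ?Q"
    proof (rule runs_SeqI[OF runs_Basic[OF ys(1) refl ys(2)]])
      define m3 where "m3 = m2(10 := m2 14, 11 := m 4 + (2 * lo2 + c) * k, 12 := m 4 + (2 * x + c) * k, 13 := L2)"
      fix m3' assume "m3' = fold effect ys m2"
      hence m3': "m3' = m3" using ys(3)[OF m2m] by (simp add: m3_def)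
      have m3m: "m3 z = m z" if "z \<notin> {10, 11, 12, 13, 14, 15, 16}" for z
        using m2m that by (simp add: m3_def)
      have m3h: "m3 (m 4 + z) = m (m 4 + z)" for z
        using high_neq[OF SB[of z]] by (intro m3m) simp
      have r: "m3 10 = m2 14" "m3 11 = m 4 + (2 * lo2 + c) * k" "m3 12 = m 4 + (2 * x + c) * k" "m3 13 = L2"
        by (simp_all add: m3_def)
      have rr: "m3 2 = 1" "m3 5 = m 5" "m3 1 = k" "m3 3 = 2 * k"
        using m3m m by simp_all
      show "runs row m3' (k * (5 * N2 + 16) + 2) ?Q"
        unfolding m3'
      proof (rule runs_mono[OF runs_row[where N = N2 and k = k and v = v]])
        show "22 \<le> m3 11" "22 \<le> m3 5" "m3 5 + k \<le> m3 12"
          using m by (simp_all add: r rr)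
        show "(m3 11 + d + j * m3 3 < m3 13) = (j < N2)" if "d < k" for d j
          unfolding r rr row2 by (rule L2[OF that])
        show "m3 5 + k \<le> m3 11 + d + j * m3 3 \<and>
            (m3 11 + d + j * m3 3 < m3 12 \<or> m3 12 + k \<le> m3 11 + d + j * m3 3)"
          if "d < k" "j < N2" for d j
        proof -
          have "2 * (lo2 + j) + c < 2 * x + c \<or> Suc (2 * x + c) \<le> 2 * (lo2 + j) + c"
            using x that by auto
          hence "(2 * (lo2 + j) + c) * k + d < (2 * x + c) * k \<or>
              Suc (2 * x + c) * k \<le> (2 * (lo2 + j) + c) * k + d"
            unfolding block_le_iff[OF that(1)] block_less_iff[OF that(1)] .
          thus ?thesis unfolding r rr row2 using m(6) by auto
        qed
        show "v g = (if g = 0 then m3 10 else 0) + (\<Sum>j<N2. m3 (m3 11 + (g - 1) + j * m3 3)) + m3 (m3 12 + g)" if "g < k" for g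
          unfolding v[OF that] r rr row2 s1[symmetric] m3h by (simp add: add.assoc m3h[simplified add.assoc])
      next
        fix m' assume Q: "m' 5 = m3 5 + k \<and>
          (\<forall>g<k. m' (m3 12 + g) = m3 (m3 12 + g) + v g \<and> m' (m3 5 + g) = v g) \<and>
          (\<forall>x. x \<notin> {5, 10, 14, 15, 16, 17} \<longrightarrow> \<not> (m3 5 \<le> x \<and> x < m3 5 + k) \<longrightarrow>
             \<not> (m3 12 \<le> x \<and> x < m3 12 + k) \<longrightarrow> m' x = m3 x)"
        have fr: "m' z = m3 z" if "z \<notin> {5, 10, 14, 15, 16, 17}" "\<not> (m 5 \<le> z \<and> z < m 5 + k)"
           "\<not> (m 4 + (2 * x + c) * k \<le> z \<and> z < m 4 + (2 * x + c) * k + k)" for z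
          using Q that unfolding r rr by blast
        have "m' (m 4 + ((2 * a + c') * k + g)) =
            m (m 4 + ((2 * a + c') * k + g)) + (if a = x \<and> c' = c then v g else 0)"
          if "g < k" "c' \<le> 1" for a c' g
        proof (cases "a = x \<and> c' = c")
          case True
          thus ?thesis using Q that(1) m3h unfolding r rr by (simp add: add.assoc)
        next
          case False
          hence ne: "2 * a + c' \<noteq> 2 * x + c" using c that by presburger
          have "\<not> ((2 * x + c) * k \<le> (2 * a + c') * k + g \<and> (2 * a + c') * k + g < Suc (2 * x + c) * k)"
            unfolding block_le_iff[OF that(1)] block_less_iff[OF that(1)] using ne by linarith
          hence "m' (m 4 + ((2 * a + c') * k + g)) = m3 (m 4 + ((2 * a + c') * k + g))"
            using m(6) high_neq[OF SB] by (intro fr) auto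
          thus ?thesis using False by (simp only: m3h) simp
        qed
        moreover have "m' z = m z" if "z \<notin> {5, 10, 11, 12, 13, 14, 15, 16, 17}"
          "\<not> (m 5 \<le> z \<and> z < m 5 + k)" "z < m 4" for z
        proof -
          have "m' z = m3 z" using that by (intro fr) auto
          also have "\<dots> = m z" using that(1) by (intro m3m) blast
          finally show ?thesis .
        qed
        ultimately show "?Q m'" using Q unfolding r rr by blast
      qed (use rr in simp_all)
    qed simp
  qed simp
qed simp

text \<open>With truncated subtraction \<open>u + (v - u)\<close> is \<open>max u v\<close>. The
  last three instructions thus extend the blocks in use so that they include the current
  letter.\<close>

definition locate :: com where
  "locate =
     Basic [LoadI 16 6, Add 6 6 2, LoadC 15 0, LoadC 8 0, Add 8 8 4] ;;
     WhileGt 16 15 (Basic [Add 8 8 3, Add 15 15 2]) ;;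
     Basic [Add 15 8 3, Sub 15 15 9, Add 9 9 15]"

lemma runs_locate:
  assumes m: "m 2 = 1" "22 \<le> m 6" and x: "x = m (m 6)"
  shows "runs locate m (4 * x + 9)
    (\<lambda>m'. m' 6 = Suc (m 6) \<and> m' 8 = m 4 + x * m 3 \<and> m' 9 = max (m 9) (m 4 + Suc x * m 3) \<and>
       (\<forall>z. z \<notin> {6, 8, 9, 15, 16} \<longrightarrow> m' z = m z))"
  unfolding locate_def
proof (rule runs_SeqI[OF runs_Basic[OF _ refl order_refl]])
  fix m1 assume "m1 = fold effect [LoadI 16 6, Add 6 6 2, LoadC 15 0, LoadC 8 0, Add 8 8 4] m"
  hence m1: "m1 = m(16 := x, 6 := Suc (m 6), 15 := 0, 8 := m 4)"
    using m x by (simp add: fun_eq_iff)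
  let ?I = "\<lambda>j m'. m' 15 = j \<and> m' 8 = m 4 + j * m 3 \<and> (\<forall>z. z \<notin> {8, 15} \<longrightarrow> m' z = m1 z)"
  show "runs (WhileGt 16 15 (Basic [Add 8 8 3, Add 15 15 2]) ;; Basic [Add 15 8 3, Sub 15 15 9, Add 9 9 15]) m1
     (4 * x + 4) (\<lambda>m'. m' 6 = Suc (m 6) \<and> m' 8 = m 4 + x * m 3 \<and> m' 9 = max (m 9) (m 4 + Suc x * m 3) \<and>
       (\<forall>z. z \<notin> {6, 8, 9, 15, 16} \<longrightarrow> m' z = m z))"
  proof (rule runs_SeqI)
    show "runs (WhileGt 16 15 (Basic [Add 8 8 3, Add 15 15 2])) m1 (x * (2 + 2) + 1) (?I x)"
    proof (rule runs_While)
      fix j m' assume j: "j < x" and I: "?I j m'"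
      have "m' 3 = m 3" "m' 2 = 1" "m' 16 = x" using I m by (simp_all add: m1)
      thus "m' 15 < m' 16 \<and> runs (Basic [Add 8 8 3, Add 15 15 2]) m' 2 (?I (Suc j))"
        using I j by (auto intro!: runs_Basic)
    qed (simp_all add: m1)
  next
    fix m2 assume I: "?I x m2"
    have r: "m2 3 = m 3" "m2 9 = m 9" "m2 6 = Suc (m 6)" using I by (simp_all add: m1)
    have e: "fold effect [Add 15 8 3, Sub 15 15 9, Add 9 9 15] m2 =
        m2(15 := m 4 + Suc x * m 3 - m 9, 9 := max (m 9) (m 4 + Suc x * m 3))"
      using I by (simp add: fun_eq_iff r max_def ac_simps)
    show "runs (Basic [Add 15 8 3, Sub 15 15 9, Add 9 9 15]) m2 3
      (\<lambda>m'. m' 6 = Suc (m 6) \<and> m' 8 = m 4 + x * m 3 \<and> m' 9 = max (m 9) (m 4 + Suc x * m 3) \<and>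
       (\<forall>z. z \<notin> {6, 8, 9, 15, 16} \<longrightarrow> m' z = m z))"
      by (rule runs_Basic, simp, unfold e) (use I r in \<open>auto simp: m1\<close>)
  qed simp
qed auto

text \<open>The first sum starts \<open>3 * k + (k - 2)\<close> cells behind the block pair address
  in cell 8. This skips both blocks of the current letter and the \<open>Up\<close> block of the
  next one, and leads to column \<open>k - 2\<close> of its \<open>Down\<close> block.\<close>

definition up_part :: com where
  "up_part =
     Basic [LoadC 14 1, Add 15 8 3, Add 15 15 1, Add 15 15 18, LoadC 13 0, Add 13 13 9] ;;
     sum_loop ;;
     Basic [LoadC 10 0, Add 10 10 14, LoadC 11 0, Add 11 11 4, LoadC 12 0, Add 12 12 8,
       LoadC 13 0, Add 13 13 8] ;;
     row"

definition down_part :: com where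
  "down_part =
     Basic [LoadC 14 1, Add 15 4 18, LoadC 13 0, Add 13 13 8] ;;
     sum_loop ;;
     Basic [LoadC 10 0, Add 10 10 14, Add 11 8 3, Add 11 11 1, Add 12 8 1, LoadC 13 0, Add 13 13 9] ;;
     row"

definition half_post :: "nat \<Rightarrow> nat \<Rightarrow> nat \<Rightarrow> (nat \<Rightarrow> nat) \<Rightarrow> mem \<Rightarrow> mem \<Rightarrow> bool" where
  "half_post k x c v m m' \<longleftrightarrow> m' 5 = m 5 + k \<and> (\<forall>g<k. m' (m 5 + g) = v g) \<and>
      (\<forall>a c' g. g < k \<longrightarrow> c' \<le> 1 \<longrightarrow> m' (m 4 + ((2 * a + c') * k + g)) =
          m (m 4 + ((2 * a + c') * k + g)) + (if a = x \<and> c' = c then v g else 0)) \<and>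
      (\<forall>z. z \<notin> {5, 10, 11, 12, 13, 14, 15, 16, 17} \<longrightarrow> \<not> (m 5 \<le> z \<and> z < m 5 + k) \<longrightarrow> z < m 4 \<longrightarrow> m' z = m z)"

lemma runs_up_part:
  assumes m: "m 2 = 1" "m 1 = k" "1 \<le> k" "m 3 = 2 * k" "22 \<le> m 5" "m 5 + k \<le> m 4"
    "m 18 = k - 2" "m 8 = m 4 + x * (2 * k)" "m 9 = m 4 + e * (2 * k)" "x < e"
    and v: "\<And>g. g < k \<Longrightarrow> v g =
      (if g = 0 then 1 + (\<Sum>j<e - Suc x. m (m 4 + ((2 * (Suc x + j) + 1) * k + (k - 2)))) else 0) +
      (\<Sum>j<x. m (m 4 + ((2 * (0 + j) + 0) * k + (g - 1)))) + m (m 4 + ((2 * x + 0) * k + g))"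
  shows "runs up_part m (5 * (e - Suc x) + k * (5 * x + 16) + 17) (half_post k x 0 v m)"
  unfolding up_part_def half_post_def
proof (rule runs_half[where ?lo1.0 = "Suc x" and ?c1.0 = 1 and ?N1.0 = "e - Suc x" and ?lo2.0 = 0 and ?N2.0 = x
      and ?L2.0 = "m 8" and ?m1.0 = "m(14 := 1, 15 := m 4 + ((2 * Suc x + 1) * k + (k - 2)), 13 := m 9)"])
  show "fold effect [LoadC 14 1, Add 15 8 3, Add 15 15 1, Add 15 15 18, LoadC 13 0, Add 13 13 9] m =
      m(14 := 1, 15 := m 4 + ((2 * Suc x + 1) * k + (k - 2)), 13 := m 9)"
    using m by (simp add: fun_eq_iff algebra_simps)
next
  fix j d assume d: "d < k"
  have "m 4 + ((2 * (Suc x + j) + 1) * k + d) < m 9 \<longleftrightarrow> 2 * (Suc x + j) + 1 < 2 * e"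
    unfolding m(9) mult.assoc[symmetric] mult.commute[of e 2] nat_add_left_cancel_less block_less_iff[OF d] ..
  also have "\<dots> \<longleftrightarrow> j < e - Suc x" by auto
  finally show "(m 4 + ((2 * (Suc x + j) + 1) * k + d)
       < (m(14 := 1, 15 := m 4 + ((2 * Suc x + 1) * k + (k - 2)), 13 := m 9)) 13) = (j < e - Suc x)"
    by simp
next
  fix m' assume fr: "\<And>z. z \<notin> {13, 14, 15, 16} \<Longrightarrow> m' z = m z"
  have "m' 4 = m 4" "m' 8 = m 8" using fr by simp_all
  thus "fold effect [LoadC 10 0, Add 10 10 14, LoadC 11 0, Add 11 11 4, LoadC 12 0, Add 12 12 8,
       LoadC 13 0, Add 13 13 8] m' =
      m'(10 := m' 14, 11 := m 4 + (2 * 0 + 0) * k, 12 := m 4 + (2 * x + 0) * k, 13 := m 8)"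
    using m by (simp add: fun_eq_iff algebra_simps)
next
  fix j d assume d: "d < k"
  have "m 4 + ((2 * (0 + j) + 0) * k + d) < m 8 \<longleftrightarrow> 2 * (0 + j) + 0 < 2 * x"
    unfolding m(8) mult.assoc[symmetric] mult.commute[of x 2] nat_add_left_cancel_less block_less_iff[OF d] ..
  thus "(m 4 + ((2 * (0 + j) + 0) * k + d) < m 8) = (j < x)" by simp
qed (use m v in simp_all)

lemma runs_down_part:
  assumes m: "m 2 = 1" "m 1 = k" "1 \<le> k" "m 3 = 2 * k" "22 \<le> m 5" "m 5 + k \<le> m 4"
    "m 18 = k - 2" "m 8 = m 4 + x * (2 * k)" "m 9 = m 4 + e * (2 * k)" "x < e"
    and v: "\<And>g. g < k \<Longrightarrow> v g =
      (if g = 0 then 1 + (\<Sum>j<x. m (m 4 + ((2 * (0 + j) + 0) * k + (k - 2)))) else 0) +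
      (\<Sum>j<e - Suc x. m (m 4 + ((2 * (Suc x + j) + 1) * k + (g - 1)))) + m (m 4 + ((2 * x + 1) * k + g))"
  shows "runs down_part m (5 * x + k * (5 * (e - Suc x) + 16) + 17) (half_post k x 1 v m)"
  unfolding down_part_def half_post_def
proof (rule runs_half[where ?lo1.0 = 0 and ?c1.0 = 0 and ?N1.0 = x and ?lo2.0 = "Suc x" and ?N2.0 = "e - Suc x"
      and ?L2.0 = "m 9" and ?m1.0 = "m(14 := 1, 15 := m 4 + ((2 * 0 + 0) * k + (k - 2)), 13 := m 8)"])
  show "fold effect [LoadC 14 1, Add 15 4 18, LoadC 13 0, Add 13 13 8] m =
      m(14 := 1, 15 := m 4 + ((2 * 0 + 0) * k + (k - 2)), 13 := m 8)"
    using m by (simp add: fun_eq_iff)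
next
  fix j d assume d: "d < k"
  have "m 4 + ((2 * (Suc x + j) + 1) * k + d) < m 9 \<longleftrightarrow> 2 * (Suc x + j) + 1 < 2 * e"
    unfolding m(9) mult.assoc[symmetric] mult.commute[of e 2] nat_add_left_cancel_less block_less_iff[OF d] ..
  also have "\<dots> \<longleftrightarrow> j < e - Suc x" by auto
  finally show "(m 4 + ((2 * (Suc x + j) + 1) * k + d) < m 9) = (j < e - Suc x)"
    by simp
next
  fix m' assume fr: "\<And>z. z \<notin> {13, 14, 15, 16} \<Longrightarrow> m' z = m z"
  have "m' 4 = m 4" "m' 8 = m 8" "m' 3 = m 3" "m' 1 = m 1" "m' 9 = m 9" using fr by simp_all
  thus "fold effect [LoadC 10 0, Add 10 10 14, Add 11 8 3, Add 11 11 1, Add 12 8 1, LoadC 13 0, Add 13 13 9] m' =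
      m'(10 := m' 14, 11 := m 4 + (2 * Suc x + 1) * k, 12 := m 4 + (2 * x + 1) * k, 13 := m 9)"
    using m by (simp add: fun_eq_iff algebra_simps)
next
  fix j d assume d: "d < k"
  have "m 4 + ((2 * (0 + j) + 0) * k + d) < m 8 \<longleftrightarrow> 2 * (0 + j) + 0 < 2 * x"
    unfolding m(8) mult.assoc[symmetric] mult.commute[of x 2] nat_add_left_cancel_less block_less_iff[OF d] ..
  thus "(m 4 + ((2 * (0 + j) + 0) * k + d) <
     (m(14 := 1, 15 := m 4 + ((2 * 0 + 0) * k + (k - 2)), 13 := m 8)) 13) = (j < x)" by simp
qed (use m v in simp_all)

definition body :: com where
  "body = locate ;; up_part ;; down_part"

lemma runs_body:
  assumes m: "m 2 = 1" "m 1 = k" "1 \<le> k" "m 3 = 2 * k" "22 \<le> m 6" "m 6 < m 5" "m 5 + 2 * k \<le> m 4"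
    "m 18 = k - 2" "m 9 = m 4 + e * (2 * k)"
    and x: "x = m (m 6)" and e': "e' = max e (Suc x)"
    and v0: "\<And>g. g < k \<Longrightarrow> v0 g =
      (if g = 0 then 1 + (\<Sum>j<e' - Suc x. m (m 4 + ((2 * (Suc x + j) + 1) * k + (k - 2)))) else 0) +
      (\<Sum>j<x. m (m 4 + ((2 * (0 + j) + 0) * k + (g - 1)))) + m (m 4 + ((2 * x + 0) * k + g))"
    and v1: "\<And>g. g < k \<Longrightarrow> v1 g =
      (if g = 0 then 1 + (\<Sum>j<x. m (m 4 + ((2 * (0 + j) + 0) * k + (k - 2)))) else 0) +
      (\<Sum>j<e' - Suc x. m (m 4 + ((2 * (Suc x + j) + 1) * k + (g - 1)))) + m (m 4 + ((2 * x + 1) * k + g))"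
  shows "runs body m (4 * x + 5 * (e' - 1) + 43 + k * (5 * (e' - 1) + 32))
    (\<lambda>m'. m' 5 = m 5 + 2 * k \<and> m' 6 = Suc (m 6) \<and> m' 9 = m 4 + e' * (2 * k) \<and>
      (\<forall>g<k. m' (m 5 + g) = v0 g \<and> m' (m 5 + k + g) = v1 g) \<and>
      (\<forall>a c g. g < k \<longrightarrow> c \<le> 1 \<longrightarrow> m' (m 4 + ((2 * a + c) * k + g)) =
          m (m 4 + ((2 * a + c) * k + g)) + (if a = x then if c = 0 then v0 g else v1 g else 0)) \<and>
      (\<forall>z. z \<notin> {5, 6, 8, 9, 10, 11, 12, 13, 14, 15, 16, 17} \<longrightarrow> \<not> (m 5 \<le> z \<and> z < m 5 + 2 * k) \<longrightarrow>
          z < m 4 \<longrightarrow> m' z = m z))"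
    (is "runs _ _ _ ?Q")
  unfolding body_def
proof (rule runs_SeqI[OF runs_locate[OF m(1,5) x]])
  fix m1 assume A: "m1 6 = Suc (m 6) \<and> m1 8 = m 4 + x * m 3 \<and> m1 9 = max (m 9) (m 4 + Suc x * m 3) \<and>
       (\<forall>z. z \<notin> {6, 8, 9, 15, 16} \<longrightarrow> m1 z = m z)"
  have fr1: "m1 z = m z" if "z \<notin> {6, 8, 9, 15, 16}" for z using A that by blast
  have r1: "m1 2 = 1" "m1 1 = k" "m1 3 = 2 * k" "m1 4 = m 4" "m1 5 = m 5" "m1 18 = k - 2"
    "m1 8 = m 4 + x * (2 * k)" using fr1 A m by simp_all
  have r1e: "m1 9 = m 4 + e' * (2 * k)"
    using A by (simp only: m e' nat_mult_max_left nat_add_max_right)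
  have SB: "22 \<le> m 4 + z" for z using m by simp
  have h1: "m1 (m 4 + z) = m (m 4 + z)" for z
    using high_neq[OF SB[of z]] by (intro fr1) blast
  show "runs (up_part ;; down_part) m1 (5 * (e' - 1) + 34 + k * (5 * (e' - 1) + 32)) ?Q"
  proof (rule runs_SeqI[OF runs_up_part[where k = k and x = x and e = e' and v = v0]])
    fix m2 assume B: "half_post k x 0 v0 m1 m2"
    have fr2: "m2 z = m1 z" if "z \<notin> {5, 10, 11, 12, 13, 14, 15, 16, 17}" "\<not> (m 5 \<le> z \<and> z < m 5 + k)" "z < m 4" for z
      using B that unfolding half_post_def r1 by blast
    have low2: "m2 z = m1 z" if "z \<notin> {5, 10, 11, 12, 13, 14, 15, 16, 17}" "z < 22" for z
      using that m by (intro fr2) auto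
    have r2: "m2 2 = 1" "m2 1 = k" "m2 3 = 2 * k" "m2 4 = m 4" "m2 18 = k - 2"
      "m2 8 = m 4 + x * (2 * k)" "m2 9 = m 4 + e' * (2 * k)" "m2 6 = Suc (m 6)"
      using low2 r1 r1e A by simp_all
    have r2': "m2 5 = m 5 + k" using B by (simp add: half_post_def r1)
    have h2: "m2 (m 4 + ((2 * a + c) * k + g)) =
        m (m 4 + ((2 * a + c) * k + g)) + (if a = x \<and> c = 0 then v0 g else 0)"
      if "g < k" "c \<le> 1" for a c g
      using B that unfolding half_post_def r1 h1 by blast
    show "runs down_part m2 (5 * x + k * (5 * (e' - Suc x) + 16) + 17) ?Q"
    proof (rule runs_mono[OF runs_down_part[where k = k and x = x and e = e' and v = v1]])
      fix g assume g: "g < k"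
      \<comment> \<open>The preceding half changed only the \<open>Up\<close> block of
        \<open>x\<close>. The cells read now belong to \<open>Up\<close> blocks of smaller letters
        or to \<open>Down\<close> blocks, so they still have their old values.\<close>
      have "m2 (m 4 + ((2 * (0 + j) + 0) * k + (k - 2))) = m (m 4 + ((2 * (0 + j) + 0) * k + (k - 2)))"
        if "j < x" for j using h2[of "k - 2" 0 "0 + j"] that m(3) by simp
      moreover have "m2 (m 4 + ((2 * (Suc x + j) + 1) * k + (g - 1))) = m (m 4 + ((2 * (Suc x + j) + 1) * k + (g - 1)))"
        for j using h2[of "g - 1" 1 "Suc x + j"] g by simp
      moreover have "m2 (m 4 + ((2 * x + 1) * k + g)) = m (m 4 + ((2 * x + 1) * k + g))"
        using h2[of g 1 x] g by simp
      ultimately show "v1 g =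
         (if g = 0 then 1 + (\<Sum>j<x. m2 (m2 4 + ((2 * (0 + j) + 0) * k + (k - 2)))) else 0) +
         (\<Sum>j<e' - Suc x. m2 (m2 4 + ((2 * (Suc x + j) + 1) * k + (g - 1)))) +
         m2 (m2 4 + ((2 * x + 1) * k + g))"
        unfolding v1[OF g] r2 by (simp cong: sum.cong_simp)
    next
      fix m3 assume C: "half_post k x 1 v1 m2 m3"
      have fr3: "m3 z = m2 z"
        if "z \<notin> {5, 10, 11, 12, 13, 14, 15, 16, 17}" "\<not> (m 5 + k \<le> z \<and> z < m 5 + k + k)" "z < m 4" for z
        using C that unfolding half_post_def r2 r2' by blast
      have "m3 5 = m 5 + 2 * k" using C by (simp add: half_post_def r2')
      moreover have "m3 6 = Suc (m 6)" "m3 9 = m 4 + e' * (2 * k)"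
        using fr3[of 6] fr3[of 9] r2 m by simp_all
      moreover have "m3 (m 5 + g) = v0 g" "m3 (m 5 + k + g) = v1 g" if "g < k" for g
      proof -
        have "22 \<le> m 5 + g" using m by simp
        hence "m3 (m 5 + g) = m2 (m 5 + g)"
          using high_neq[of "m 5 + g"] that m by (intro fr3) auto
        thus "m3 (m 5 + g) = v0 g" using B that by (simp add: half_post_def r1)
        show "m3 (m 5 + k + g) = v1 g" using C that by (simp add: half_post_def r2')
      qed
      moreover have "m3 (m 4 + ((2 * a + c) * k + g)) =
          m (m 4 + ((2 * a + c) * k + g)) + (if a = x then if c = 0 then v0 g else v1 g else 0)"
        if "g < k" "c \<le> 1" for a c g
      proof -
        have "m3 (m 4 + ((2 * a + c) * k + g)) =
          m2 (m 4 + ((2 * a + c) * k + g)) + (if a = x \<and> c = 1 then v1 g else 0)"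
          using C that unfolding half_post_def r2 by blast
        moreover have "c = 0 \<or> c = 1" using that by auto
        ultimately show ?thesis using h2[OF that] by auto
      qed
      moreover have "m3 z = m z"
        if "z \<notin> {5, 6, 8, 9, 10, 11, 12, 13, 14, 15, 16, 17}" "\<not> (m 5 \<le> z \<and> z < m 5 + 2 * k)" "z < m 4" for z
      proof -
        have "m3 z = m2 z" using that by (intro fr3) auto
        also have "\<dots> = m1 z" using that by (intro fr2) auto
        also have "\<dots> = m z" using that(1) by (intro fr1) blast
        finally show ?thesis .
      qed
      ultimately show "?Q m3" by blast
    qed (use m r2 r2' e' in auto)
  next
    \<comment> \<open>The two halves sum over the letters below and above \<open>x\<close> with
      exchanged roles, so their total cost depends on the number \<open>e' - 1\<close> of other
      letters only.\<close>
    have *: "e' - Suc x + x = e' - 1" using e' by auto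
    have "5 * (e' - Suc x) + k * (5 * x + 16) + 17 + (5 * x + k * (5 * (e' - Suc x) + 16) + 17) =
        5 * (e' - Suc x + x) + 34 + k * (5 * (e' - Suc x + x) + 32)"
      by (simp add: algebra_simps)
    thus "5 * (e' - Suc x) + k * (5 * x + 16) + 17 + (5 * x + k * (5 * (e' - Suc x) + 16) + 17)
      \<le> 5 * (e' - 1) + 34 + k * (5 * (e' - 1) + 32)"
      unfolding * by simp
  qed (use m r1 r1e e' v0 h1 in auto)
qed simp

subsection \<open>The main loop\<close>

definition letter_sum :: "nat list \<Rightarrow> nat \<Rightarrow> nat \<Rightarrow> orient \<Rightarrow> nat \<Rightarrow> nat \<Rightarrow> nat" where
  "letter_sum w k i d g a = (\<Sum>j | j < i \<and> w ! j = a. rc_table w k j d (Suc g))"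

lemma letter_sum_0 [simp]: "letter_sum w k 0 d g a = 0"
  by (simp add: letter_sum_def)

lemma letter_sum_Suc:
  "letter_sum w k (Suc i) d g a =
     letter_sum w k i d g a + (if a = w ! i then rc_table w k i d (Suc g) else 0)"
proof -
  have "{j. j < Suc i \<and> w ! j = a} = {j. j < i \<and> w ! j = a} \<union> (if a = w ! i then {i} else {})"
    by (auto simp: less_Suc_eq)
  thus ?thesis by (simp add: letter_sum_def)
qed

lemma sum_letter_sum:
  assumes "finite A"
  shows "(\<Sum>a\<in>A. letter_sum w k i d g a) = (\<Sum>j | j < i \<and> w ! j \<in> A. rc_table w k j d (Suc g))"
proof -
  have "(\<Sum>a\<in>A. \<Sum>j \<in> {j \<in> {j. j < i \<and> w ! j \<in> A}. w ! j = a}. rc_table w k j d (Suc g)) =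
      (\<Sum>j | j < i \<and> w ! j \<in> A. rc_table w k j d (Suc g))"
    by (rule sum.group) (use assms in auto)
  moreover have "{j \<in> {j. j < i \<and> w ! j \<in> A}. w ! j = a} = {j. j < i \<and> w ! j = a}" if "a \<in> A" for a
    using that by auto
  ultimately show ?thesis by (simp add: letter_sum_def cong: sum.cong_simp)
qed

lemma ordlt_simps: "ordlt Up x y \<longleftrightarrow> x < y" "ordlt Down x y \<longleftrightarrow> y < x"
  by (auto simp: ordlt_def ordle_def)

lemma sum_letters_below: "(\<Sum>j | j < i \<and> w ! j < x. rc_table w k j d (Suc g)) = (\<Sum>a<x. letter_sum w k i d g (0 + a))"
  using sum_letter_sum[of "{..<x}" w k i d g] by simp

text \<open>Letters from \<open>e\<close> on have not occurred yet and contribute empty sums. Any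
  strict bound on the letters seen therefore serves as the end of the range, in particular the one
  the program maintains.\<close>

lemma sum_letters_above:
  assumes "\<forall>j<i. w ! j < e"
  shows "(\<Sum>j | j < i \<and> x < w ! j. rc_table w k j d (Suc g)) = (\<Sum>a<e - Suc x. letter_sum w k i d g (Suc x + a))"
proof -
  have "{j. j < i \<and> x < w ! j} = {j. j < i \<and> w ! j \<in> {Suc x..<e}}" using assms by auto
  hence "(\<Sum>j | j < i \<and> x < w ! j. rc_table w k j d (Suc g)) = (\<Sum>a\<in>{Suc x..<e}. letter_sum w k i d g a)"
    by (simp only: sum_letter_sum[OF finite_atLeastLessThan])
  also have "\<dots> = (\<Sum>a\<in>{0..<e - Suc x}. letter_sum w k i d g (Suc x + a))"
    using sum.atLeastLessThan_shift_0[of "letter_sum w k i d g" "Suc x" e] by (simp only: comp_def)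
  finally show ?thesis by (simp add: atLeast0LessThan)
qed

lemma rc_table_letter_sums:
  assumes i: "i < length w" and e: "\<forall>j<i. w ! j < e"
  shows "rc_table w k i Up (Suc g) =
      (if g = 0 then 1 + (\<Sum>a<e - Suc (w ! i). letter_sum w k i Down (k - 2) (Suc (w ! i) + a)) else 0) +
      (\<Sum>a<w ! i. letter_sum w k i Up (g - 1) (0 + a)) + letter_sum w k i Up g (w ! i)"
    and "rc_table w k i Down (Suc g) =
      (if g = 0 then 1 + (\<Sum>a<w ! i. letter_sum w k i Up (k - 2) (0 + a)) else 0) +
      (\<Sum>a<e - Suc (w ! i). letter_sum w k i Down (g - 1) (Suc (w ! i) + a)) + letter_sum w k i Down g (w ! i)"
proof -
  \<comment> \<open>Columns count from zero, so truncated subtraction of columns replaces the maxima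
    with one in the recurrence.\<close>
  have mx: "max 1 (Suc g - 1) = Suc (g - 1)" "max 1 (k - 1) = Suc (k - 2)" by auto
  have same: "(\<Sum>j | j < i \<and> w ! j = w ! i. rc_table w k j d (Suc g)) = letter_sum w k i d g (w ! i)" for d
    by (simp add: letter_sum_def)
  have le: "Suc g \<le> 1 \<longleftrightarrow> g = 0" by simp
  show "rc_table w k i Up (Suc g) =
      (if g = 0 then 1 + (\<Sum>a<e - Suc (w ! i). letter_sum w k i Down (k - 2) (Suc (w ! i) + a)) else 0) +
      (\<Sum>a<w ! i. letter_sum w k i Up (g - 1) (0 + a)) + letter_sum w k i Up g (w ! i)"
    unfolding rc_table_rec[OF i, of k Up "Suc g"] mx le opp.simps ordlt_simps sum_letters_below same
    using sum_letters_above[OF e, where d = Down] by (cases "g = 0") simp_all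
  show "rc_table w k i Down (Suc g) =
      (if g = 0 then 1 + (\<Sum>a<w ! i. letter_sum w k i Up (k - 2) (0 + a)) else 0) +
      (\<Sum>a<e - Suc (w ! i). letter_sum w k i Down (g - 1) (Suc (w ! i) + a)) + letter_sum w k i Down g (w ! i)"
    unfolding rc_table_rec[OF i, of k Down "Suc g"] mx le opp.simps ordlt_simps same
      sum_letters_above[OF e]
    using sum_letters_below[where d = Up] by (cases "g = 0") simp_all
qed

definition main_loop :: com where
  "main_loop = WhileGt 7 6 body"

lemma runs_main_loop:
  assumes m: "m 2 = 1" "m 1 = k" "1 \<le> k" "m 3 = 2 * k" "m 6 = W" "m 7 = W + length w" "22 \<le> W"
    "m 5 = TB" "W + length w \<le> TB" "m 4 = TB + length w * (2 * k)" "m 18 = k - 2" "m 9 = m 4"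
    and w: "\<And>j. j < length w \<Longrightarrow> m (W + j) = w ! j" "\<And>j. j < length w \<Longrightarrow> w ! j \<le> s"
    and zero: "\<And>z. m 4 \<le> z \<Longrightarrow> m z = 0"
  shows "runs main_loop m (length w * (9 * s + 45 + k * (5 * s + 32)) + 1)
    (\<lambda>m'. (\<forall>i<length w. \<forall>d. \<forall>g<k. m' (TB + ((2 * i + orient_code d) * k + g)) = rc_table w k i d (Suc g)) \<and>
      m' 0 = m 0 \<and> m' 2 = 1 \<and> m' 4 = m 4)"
proof -
  let ?n = "length w"
  \<comment> \<open>The witness \<open>e\<close> is the end of the blocks in use, counted in
    letters; initially it is zero. The frame condition below \<open>TB\<close> preserves the
    constants in the registers and the copied word.\<close>
  define Inv where "Inv i m' \<longleftrightarrow> m' 5 = TB + i * (2 * k) \<and> m' 6 = W + i \<and>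
    (\<exists>e\<le>Suc s. m' 9 = m 4 + e * (2 * k) \<and> (\<forall>j<i. w ! j < e)) \<and>
    (\<forall>j<i. \<forall>d. \<forall>g<k. m' (TB + ((2 * j + orient_code d) * k + g)) = rc_table w k j d (Suc g)) \<and>
    (\<forall>a d g. g < k \<longrightarrow> m' (m 4 + ((2 * a + orient_code d) * k + g)) = letter_sum w k i d g a) \<and>
    (\<forall>z. z \<notin> {5, 6, 8, 9, 10, 11, 12, 13, 14, 15, 16, 17} \<longrightarrow> z < TB \<longrightarrow> m' z = m z)" for i m'
  have step: "runs body m' (9 * s + 43 + k * (5 * s + 32)) (Inv (Suc i))"
    if i: "i < ?n" and I: "Inv i m'" for i m'
  proof -
    obtain e where e: "e \<le> Suc s" "m' 9 = m 4 + e * (2 * k)" "\<And>j. j < i \<Longrightarrow> w ! j < e"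
      using I by (auto simp: Inv_def)
    have fr: "m' z = m z" if "z \<notin> {5, 6, 8, 9, 10, 11, 12, 13, 14, 15, 16, 17}" "z < TB" for z
      using I that unfolding Inv_def by blast
    have low: "m' z = m z" if "z \<notin> {5, 6, 8, 9, 10, 11, 12, 13, 14, 15, 16, 17}" "z < 22" for z
      using that m by (intro fr) auto
    have r: "m' 2 = 1" "m' 1 = k" "m' 3 = 2 * k" "m' 4 = m 4" "m' 18 = k - 2"
      using low m by simp_all
    have r5: "m' 5 = TB + i * (2 * k)" and r6: "m' 6 = W + i" using I by (simp_all add: Inv_def)
    have "22 \<le> W + i" using m by simp
    hence xi: "w ! i = m' (m' 6)"
      using high_neq[of "W + i"] w(1)[OF i] m(9) i fr[of "W + i"] by (simp add: r6)
    have ls: "m' (m 4 + ((2 * a + orient_code d) * k + g)) = letter_sum w k i d g a" if "g < k" for a d g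
      using I that by (simp add: Inv_def)
    have lsU: "m' (m 4 + ((2 * a + 0) * k + g)) = letter_sum w k i Up g a" if "g < k" for a g
      using ls[OF that, of a Up] by (simp only: orient_code_def) simp
    have lsD: "m' (m 4 + ((2 * a + 1) * k + g)) = letter_sum w k i Down g a" if "g < k" for a g
      using ls[OF that, of a Down] by (simp only: orient_code_def) simp
    define e' where "e' = max e (Suc (w ! i))"
    have ee: "\<forall>j<i. w ! j < e'" using e(3) by (auto simp: e'_def less_max_iff_disj)
    have e's: "e' - 1 \<le> s" "e' \<le> Suc s" using e w(2)[OF i] by (auto simp: e'_def)
    have kk: "k - 2 < k" using m(3) by simp
    have Si: "Suc i * (2 * k) \<le> ?n * (2 * k)" using i by (intro mult_le_mono1) simp
    show ?thesis
    proof (rule runs_mono[OF runs_body[where k = k and e = e and e' = e' and x = "w ! i"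
        and ?v0.0 = "\<lambda>g. rc_table w k i Up (Suc g)" and ?v1.0 = "\<lambda>g. rc_table w k i Down (Suc g)"]])
      fix g assume g: "g < k"
      hence g': "g - 1 < k" by simp
      show "rc_table w k i Up (Suc g) =
         (if g = 0 then 1 + (\<Sum>j<e' - Suc (w ! i). m' (m' 4 + ((2 * (Suc (w ! i) + j) + 1) * k + (k - 2)))) else 0) +
         (\<Sum>j<w ! i. m' (m' 4 + ((2 * (0 + j) + 0) * k + (g - 1)))) + m' (m' 4 + ((2 * (w ! i) + 0) * k + g))"
        unfolding rc_table_letter_sums(1)[OF i ee] r
        by (simp only: lsU[OF g] lsU[OF g'] lsD[OF kk])
      show "rc_table w k i Down (Suc g) =
         (if g = 0 then 1 + (\<Sum>j<w ! i. m' (m' 4 + ((2 * (0 + j) + 0) * k + (k - 2)))) else 0) +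
         (\<Sum>j<e' - Suc (w ! i). m' (m' 4 + ((2 * (Suc (w ! i) + j) + 1) * k + (g - 1)))) +
         m' (m' 4 + ((2 * (w ! i) + 1) * k + g))"
        unfolding rc_table_letter_sums(2)[OF i ee] r
        by (simp only: lsD[OF g] lsD[OF g'] lsU[OF kk])
    next
      fix m'' assume B: "m'' 5 = m' 5 + 2 * k \<and> m'' 6 = Suc (m' 6) \<and> m'' 9 = m' 4 + e' * (2 * k) \<and>
        (\<forall>g<k. m'' (m' 5 + g) = rc_table w k i Up (Suc g) \<and> m'' (m' 5 + k + g) = rc_table w k i Down (Suc g)) \<and>
        (\<forall>a c g. g < k \<longrightarrow> c \<le> 1 \<longrightarrow> m'' (m' 4 + ((2 * a + c) * k + g)) =
          m' (m' 4 + ((2 * a + c) * k + g)) +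
          (if a = w ! i then if c = 0 then rc_table w k i Up (Suc g) else rc_table w k i Down (Suc g) else 0)) \<and>
        (\<forall>z. z \<notin> {5, 6, 8, 9, 10, 11, 12, 13, 14, 15, 16, 17} \<longrightarrow> \<not> (m' 5 \<le> z \<and> z < m' 5 + 2 * k) \<longrightarrow>
          z < m' 4 \<longrightarrow> m'' z = m' z)"
      have fr2: "m'' z = m' z" if "z \<notin> {5, 6, 8, 9, 10, 11, 12, 13, 14, 15, 16, 17}" "z < m' 5" for z
      proof -
        have "z < m' 4" using that(2) Si unfolding r r5 m(10) by simp
        thus ?thesis using B that by auto
      qed
      have "m'' (TB + ((2 * j + orient_code d) * k + g)) = rc_table w k j d (Suc g)" if "j < Suc i" "g < k" for j d g
      proof (cases "j = i")
        case True
        have addr: "TB + ((2 * j + orient_code d) * k + g) = (if d = Up then m' 5 + g else m' 5 + k + g)"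
          using True by (simp add: r5 orient_code_def algebra_simps)
        have "m'' (m' 5 + g) = rc_table w k i Up (Suc g)" "m'' (m' 5 + k + g) = rc_table w k i Down (Suc g)"
          using B that(2) by blast+
        thus ?thesis unfolding addr using True by (cases d) simp_all
      next
        case False
        have hi: "22 \<le> TB + ((2 * j + orient_code d) * k + g)" using m by simp
        have "2 * j + orient_code d < 2 * i" using False that(1) by (auto simp: orient_code_def)
        hence "(2 * j + orient_code d) * k + g < (2 * i) * k"
          unfolding block_less_iff[OF that(2)] .
        hence "TB + ((2 * j + orient_code d) * k + g) < m' 5"
          unfolding r5 by simp
        hence "m'' (TB + ((2 * j + orient_code d) * k + g)) = m' (TB + ((2 * j + orient_code d) * k + g))"
          using high_neq[OF hi] by (intro fr2) blast+
        thus ?thesis using I that False by (simp add: Inv_def)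
      qed
      moreover have "m'' (m 4 + ((2 * a + orient_code d) * k + g)) = letter_sum w k (Suc i) d g a" if "g < k" for a d g
      proof -
        have c: "orient_code d \<le> 1" by (simp add: orient_code_def)
        have "m'' (m 4 + ((2 * a + orient_code d) * k + g)) = m' (m 4 + ((2 * a + orient_code d) * k + g)) +
          (if a = w ! i then if orient_code d = 0 then rc_table w k i Up (Suc g) else rc_table w k i Down (Suc g) else 0)"
          using B that c unfolding r by blast
        thus ?thesis unfolding ls[OF that] letter_sum_Suc by (cases d) (simp_all add: orient_code_def)
      qed
      moreover have "\<exists>e\<le>Suc s. m'' 9 = m 4 + e * (2 * k) \<and> (\<forall>j<Suc i. w ! j < e)"
      proof (intro exI[of _ e'] conjI)
        show "\<forall>j<Suc i. w ! j < e'" using ee by (auto simp: less_Suc_eq e'_def)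
      qed (use B r e's in auto)
      moreover have "m'' z = m z" if "z \<notin> {5, 6, 8, 9, 10, 11, 12, 13, 14, 15, 16, 17}" "z < TB" for z
        using fr2[OF that(1)] fr[OF that] that(2) by (simp add: r5)
      ultimately show "Inv (Suc i) m''"
        using B unfolding Inv_def r5 r6 by simp
    next
      show "m' 6 < m' 5" using i m unfolding r5 r6 by simp
      show "m' 5 + 2 * k \<le> m' 4" using Si unfolding r r5 m(10) by simp
      \<comment> \<open>Locating the block costs \<open>4 * w ! i\<close> and the two turning-point
        sums \<open>5 * (e' - 1)\<close>; both arguments are at most \<open>s\<close>, which gives
        \<open>9 * s\<close>.\<close>
      show "4 * w ! i + 5 * (e' - 1) + 43 + k * (5 * (e' - 1) + 32) \<le> 9 * s + 43 + k * (5 * s + 32)"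
        using w(2)[OF i] e's(1) by (intro add_mono mult_mono) auto
    qed (use r r5 r6 e xi e'_def m in auto)
  qed
  have "runs main_loop m (?n * (9 * s + 43 + k * (5 * s + 32) + 2) + 1) (Inv ?n)"
    unfolding main_loop_def
  proof (rule runs_While)
    fix j m' assume j: "j < ?n" and I: "Inv j m'"
    have "m' 7 = m 7" "m' 6 = W + j" using I m unfolding Inv_def by simp_all
    thus "m' 6 < m' 7 \<and> runs body m' (9 * s + 43 + k * (5 * s + 32)) (Inv (Suc j))"
      using step[OF j I] m j by simp
  next
    fix m' assume I: "Inv ?n m'"
    have "m' 7 = m 7" "m' 6 = W + ?n" using I m unfolding Inv_def by simp_all
    thus "m' 7 \<le> m' 6" using m by simp
  next
    show "Inv 0 m" unfolding Inv_def using m zero by (auto intro!: exI[of _ 0])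
  qed
  thus ?thesis
  proof (rule runs_mono)
    fix m' assume I: "Inv ?n m'"
    have "m' 0 = m 0" "m' 2 = m 2" "m' 4 = m 4" using I m unfolding Inv_def by simp_all
    thus "(\<forall>i<?n. \<forall>d. \<forall>g<k. m' (TB + ((2 * i + orient_code d) * k + g)) = rc_table w k i d (Suc g)) \<and>
      m' 0 = m 0 \<and> m' 2 = 1 \<and> m' 4 = m 4" using I m unfolding Inv_def by simp
  qed simp
qed

subsection \<open>Relocating the input and the output\<close>

lemma funpow_effect_Add: "(effect (Add 0 0 (Suc 0)) ^^ c) m = m(0 := m 0 + c * m 1)"
  by (induction c) (auto simp: fun_eq_iff)

lemma funpow_effect_Sub: "(effect (Sub 7 7 (Suc 0)) ^^ c) m = m(7 := m 7 - c * m 1)"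
  by (induction c) (auto simp: fun_eq_iff)

text \<open>Cell 2 has to hold the increment one and is therefore saved beforehand, at the cell the
  pointer shows initially. This is why the pointer moves before each store.\<close>

definition save_cells :: "nat \<Rightarrow> instr list" where
  "save_cells j = concat (map (\<lambda>x. [Add 0 0 2, StoreI 0 x]) [3..<3 + j])"

lemma fold_save_cells:
  assumes "m 2 = 1" "22 \<le> m 0" "j \<le> 19"
  shows "fold effect (save_cells j) m 0 = m 0 + j"
    and "i < j \<Longrightarrow> fold effect (save_cells j) m (Suc (m 0 + i)) = m (3 + i)"
    and "x \<noteq> 0 \<Longrightarrow> \<not> (m 0 < x \<and> x \<le> m 0 + j) \<Longrightarrow> fold effect (save_cells j) m x = m x"
proof -
  have "fold effect (save_cells j) m 0 = m 0 + j \<and>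
    (\<forall>i<j. fold effect (save_cells j) m (Suc (m 0 + i)) = m (3 + i)) \<and>
    (\<forall>x. x \<noteq> 0 \<longrightarrow> \<not> (m 0 < x \<and> x \<le> m 0 + j) \<longrightarrow> fold effect (save_cells j) m x = m x)"
    using assms(3)
  proof (induction j)
    case 0
    thus ?case by (simp add: save_cells_def)
  next
    case (Suc j)
    define M where "M = fold effect (save_cells j) m"
    have M: "M 0 = m 0 + j" "\<And>i. i < j \<Longrightarrow> M (Suc (m 0 + i)) = m (3 + i)"
      "\<And>x. x \<noteq> 0 \<Longrightarrow> \<not> (m 0 < x \<and> x \<le> m 0 + j) \<Longrightarrow> M x = m x"
      using Suc unfolding M_def by auto
    have M2: "M 2 = 1" "M (3 + j) = m (3 + j)"
      using M(3)[of 2] M(3)[of "3 + j"] assms(1,2) Suc.prems by auto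
    have "save_cells (Suc j) = save_cells j @ [Add 0 0 2, StoreI 0 (3 + j)]"
      unfolding save_cells_def add_Suc_right by (subst upt_Suc_append) simp_all
    hence "fold effect (save_cells (Suc j)) m = M(0 := Suc (m 0 + j), Suc (m 0 + j) := m (3 + j))"
      using M(1) M2 by (simp add: M_def)
    thus ?case using M by (auto simp: less_Suc_eq)
  qed
  thus "fold effect (save_cells j) m 0 = m 0 + j"
    "i < j \<Longrightarrow> fold effect (save_cells j) m (Suc (m 0 + i)) = m (3 + i)"
    "x \<noteq> 0 \<Longrightarrow> \<not> (m 0 < x \<and> x \<le> m 0 + j) \<Longrightarrow> fold effect (save_cells j) m x = m x"
    by blast+
qed

text \<open>The pointer is cell 0 and the increment cell 1, as these are the only two low cells that
  can hold no output.\<close>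

definition restore_cells :: "nat \<Rightarrow> instr list" where
  "restore_cells j = concat (map (\<lambda>x. [LoadI x 0, Add 0 0 1]) [2..<2 + j])"

lemma fold_restore_cells:
  assumes "m 1 = 1" "22 \<le> m 0" "j \<le> 20"
  shows "i < j \<Longrightarrow> fold effect (restore_cells j) m (2 + i) = m (m 0 + i)"
    and "2 + j \<le> x \<Longrightarrow> fold effect (restore_cells j) m x = m x"
proof -
  have "fold effect (restore_cells j) m 0 = m 0 + j \<and> fold effect (restore_cells j) m 1 = 1 \<and>
    (\<forall>i<j. fold effect (restore_cells j) m (2 + i) = m (m 0 + i)) \<and>
    (\<forall>x. 2 + j \<le> x \<longrightarrow> fold effect (restore_cells j) m x = m x)"
    using assms(3)
  proof (induction j)
    case 0
    thus ?case using assms by (simp add: restore_cells_def)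
  next
    case (Suc j)
    define M where "M = fold effect (restore_cells j) m"
    have M: "M 0 = m 0 + j" "M 1 = 1" "\<And>i. i < j \<Longrightarrow> M (2 + i) = m (m 0 + i)"
      "\<And>x. 2 + j \<le> x \<Longrightarrow> M x = m x"
      using Suc unfolding M_def by auto
    have M2: "M (m 0 + j) = m (m 0 + j)"
      using M(4)[of "m 0 + j"] assms(2) by auto
    have "restore_cells (Suc j) = restore_cells j @ [LoadI (2 + j) 0, Add 0 0 1]"
      by (simp add: restore_cells_def)
    hence "fold effect (restore_cells (Suc j)) m = M(2 + j := m (m 0 + j), 0 := Suc (m 0 + j))"
      using M(1,2) M2 by (simp add: M_def)
    thus ?case using M by (auto simp: less_Suc_eq)
  qed
  thus "i < j \<Longrightarrow> fold effect (restore_cells j) m (2 + i) = m (m 0 + i)"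
    "2 + j \<le> x \<Longrightarrow> fold effect (restore_cells j) m x = m x"
    by blast+
qed

text \<open>Adding \<open>k\<close> to \<open>n\<close> forty times reaches free cells without any scratch register. A table for
  \<open>n < 20\<close>, the only case in which it meets the registers, has at most \<open>40 k\<close> entries, so copying it
  down does not overwrite the part from which the register cells are restored.\<close>

definition save_code :: "instr list" where
  "save_code = Sub 1 1 0 # replicate 40 (Add 0 0 1) @ [StoreI 0 2, LoadC 2 1] @ save_cells 19 @ [Add 0 0 2]"

lemma fold_save_code:
  assumes m: "m = (init_mem w k)(1 := k + length w)" and k: "1 \<le> k"
    and W: "W = length w + 40 * k" and m': "m' = fold effect save_code m"
  shows "m' 0 = W + 20" "m' 1 = k" "m' 2 = 1"
    and "i < 20 \<Longrightarrow> m' (W + i) = init_mem w k (2 + i)"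
    and "2 < x \<Longrightarrow> \<not> (W \<le> x \<and> x < W + 20) \<Longrightarrow> m' x = init_mem w k x"
proof -
  have W22: "22 \<le> W" using W k by simp
  define m1 where "m1 = (init_mem w k)(0 := W, W := init_mem w k 2, 2 := 1)"
  have I: "init_mem w k 0 = length w" "init_mem w k (Suc 0) = k" by (simp_all add: init_mem_def)
  have "fold effect (Sub 1 1 0 # replicate 40 (Add 0 0 1) @ [StoreI 0 2, LoadC 2 1]) m = m1"
    unfolding m1_def using high_neq[OF W22] W
    by (simp add: funpow_effect_Add m I fun_eq_iff)
  hence "m' = fold effect (save_cells 19 @ [Add 0 0 2]) m1"
    unfolding m' save_code_def by simp
  hence m'2: "m' = (let M = fold effect (save_cells 19) m1 in M(0 := M 0 + M 2))"
    by (simp add: Let_def)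
  have m1: "m1 2 = 1" "m1 0 = W" "m1 1 = k" "m1 W = init_mem w k 2"
    using high_neq[OF W22] by (simp_all add: m1_def I)
  note F = fold_save_cells[of m1 19, unfolded m1(2), OF m1(1) W22 order_refl]
  show "m' 0 = W + 20" "m' 1 = k" "m' 2 = 1"
    using F(1) F(3)[of 1] F(3)[of 2] m1 W22 by (simp_all add: m'2 Let_def)
  show "m' (W + i) = init_mem w k (2 + i)" if "i < 20"
  proof (cases i)
    case 0
    thus ?thesis using F(3)[of W] m1 W22 by (simp add: m'2 Let_def)
  next
    case (Suc j)
    have "m1 (3 + j) = init_mem w k (3 + j)" using that Suc W22 by (simp add: m1_def)
    thus ?thesis using F(2)[of j] Suc that by (simp add: m'2 Let_def numeral_3_eq_3)
  qed
  show "m' x = init_mem w k x" if "2 < x" "\<not> (W \<le> x \<and> x < W + 20)"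
    using F(3)[of x] that by (auto simp: m'2 Let_def m1_def)
qed

definition size_loop :: com where
  "size_loop = WhileGt 7 15 (Basic [Add 4 4 3, Add 15 15 2])"

lemma runs_size_loop:
  assumes "m 2 = 1" "m 15 = 0"
  shows "runs size_loop m (4 * m 7 + 1) (\<lambda>m'. m' 4 = m 4 + m 7 * m 3 \<and> (\<forall>x. x \<notin> {4, 15} \<longrightarrow> m' x = m x))"
proof -
  let ?I = "\<lambda>j m'. m' 15 = j \<and> m' 4 = m 4 + j * m 3 \<and> (\<forall>x. x \<notin> {4, 15} \<longrightarrow> m' x = m x)"
  have "runs size_loop m (m 7 * (2 + 2) + 1) (?I (m 7))"
    unfolding size_loop_def
  proof (rule runs_While)
    fix j m' assume j: "j < m 7" and I: "?I j m'"
    show "m' 15 < m' 7 \<and> runs (Basic [Add 4 4 3, Add 15 15 2]) m' 2 (?I (Suc j))"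
      using I j assms by (auto intro!: runs_Basic)
  qed (use assms in auto)
  thus ?thesis by (rule runs_mono) auto
qed

text \<open>The length of the word has been overwritten by the pointer; it is recovered in cell 7 by
  undoing the additions of 20 and of forty times \<open>k\<close>.\<close>

definition copy_in_code :: "instr list" where
  "copy_in_code = [LoadC 7 20, Sub 7 0 7] @ replicate 40 (Sub 7 7 1) @
     [LoadC 19 22, Add 13 19 7, LoadC 20 0, Add 20 20 0]"

text \<open>The table is placed at its prescribed start \<open>2 + n\<close> plus the displacement
  in cell 0, so that the final relocation is a uniform shift. The array \<open>S\<close> is to
  follow right behind the table.\<close>

definition layout_code :: "instr list" where
  "layout_code = [Add 3 1 1, Sub 18 1 2, Sub 18 18 2, LoadC 6 20, Sub 6 0 6, LoadC 5 2, Add 5 5 0, Add 5 5 7,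
     LoadC 15 0, Add 4 5 15]"

definition copy_out_code :: "instr list" where
  "copy_out_code = [LoadC 20 22, Add 19 20 0, LoadC 13 0, Add 13 13 4]"

definition restore_code :: "instr list" where
  "restore_code = [LoadC 1 2, Add 0 0 1, LoadC 1 1] @ restore_cells 20"

section \<open>Correctness of the relocation phases\<close>

definition prepare :: com where
  "prepare = Basic save_code ;; Basic copy_in_code ;; copy_loop ;; Basic layout_code ;; size_loop ;;
     Basic [Add 7 7 6, LoadC 9 0, Add 9 9 4]"

definition finish :: com where
  "finish = Basic copy_out_code ;; copy_loop ;; Basic restore_code"

lemma runs_prepare:
  assumes m: "m = (init_mem w k)(1 := k + length w)" and k: "1 \<le> k"
    and W: "W = length w + 40 * k" and TB: "TB = W + 22 + length w"
  shows "runs prepare m (10 * length w + 200)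
    (\<lambda>m'. m' 0 = W + 20 \<and> m' 2 = 1 \<and> m' 1 = k \<and> m' 3 = 2 * k \<and> m' 6 = W \<and> m' 7 = W + length w \<and>
      m' 5 = TB \<and> m' 4 = TB + length w * (2 * k) \<and> m' 18 = k - 2 \<and> m' 9 = m' 4 \<and>
      (\<forall>j<length w. m' (W + j) = w ! j) \<and> (\<forall>z. TB \<le> z \<longrightarrow> m' z = 0))"
    (is "runs _ _ _ ?Q")
  unfolding prepare_def
proof (rule runs_SeqI[OF runs_Basic[OF _ refl order_refl]])
  let ?n = "length w"
  have W22: "22 \<le> W" "?n + 22 \<le> W" using W k by simp_all
  have init_w: "init_mem w k (2 + i) = w ! i" if "i < ?n" for i using that by (simp add: init_mem_def)
  have init_0: "init_mem w k x = 0" if "?n + 2 \<le> x" for x using that by (simp add: init_mem_def)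
  fix m1 assume "m1 = fold effect save_code m"
  note S = fold_save_code[OF m k W this]
  \<comment> \<open>All \<open>n\<close> cells from 22 on are copied, which spares a case
    distinction on \<open>n\<close>. The cells among them behind the word are zero, because
    \<open>W\<close> exceeds \<open>n + 22\<close>.\<close>
  define m2 where "m2 = m1(7 := ?n, 19 := 22, 13 := 22 + ?n, 20 := W + 20)"
  have fold2: "fold effect copy_in_code m1 = m2"
    unfolding copy_in_code_def m2_def using S(1-3) W
    by (simp add: funpow_effect_Sub fun_eq_iff)
  show "runs (Basic copy_in_code ;; copy_loop ;; Basic layout_code ;; size_loop ;;
     Basic [Add 7 7 6, LoadC 9 0, Add 9 9 4]) m1 (10 * ?n + 118) ?Q"
  proof (rule runs_SeqI[OF runs_Basic[OF _ refl order_refl]])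
    fix m2' assume "m2' = fold effect copy_in_code m1"
    hence m2': "m2' = m2" using fold2 by simp
    have r2: "m2 2 = 1" "m2 19 = 22" "m2 20 = W + 20" "m2 13 = 22 + ?n" "m2 7 = ?n" "m2 0 = W + 20" "m2 1 = k"
      using S(1-3) by (simp_all add: m2_def)
    have hi2: "m2 x = m1 x" if "22 \<le> x" for x using high_neq[OF that] by (simp add: m2_def)
    show "runs (copy_loop ;; Basic layout_code ;; size_loop ;; Basic [Add 7 7 6, LoadC 9 0, Add 9 9 4])
        m2' (10 * ?n + 72) ?Q"
      unfolding m2'
    proof (rule runs_SeqI[OF runs_copy_loop[where N = ?n]])
      fix m3 assume A: "(\<forall>i<?n. m3 (m2 20 + i) = m2 (m2 19 + i)) \<and>
         (\<forall>x. x \<notin> {16, 19, 20} \<longrightarrow> \<not> (m2 20 \<le> x \<and> x < m2 20 + ?n) \<longrightarrow> m3 x = m2 x)"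
      have fr: "m3 x = m2 x" if "x \<notin> {16, 19, 20}" "\<not> (W + 20 \<le> x \<and> x < W + 20 + ?n)" for x
        using A that unfolding r2 by blast
      have low: "m3 x = m2 x" if "x \<notin> {16, 19, 20}" "x < 22" for x
        using that W22 by (intro fr) auto
      have r3: "m3 0 = W + 20" "m3 1 = k" "m3 2 = 1" "m3 7 = ?n"
        using low r2 by simp_all
      \<comment> \<open>The first 20 letters come from the saved register cells, the others from the
        block copied directly behind them.\<close>
      have w3: "m3 (W + j) = w ! j" if j: "j < ?n" for j
      proof (cases "j < 20")
        case True
        have h: "22 \<le> W + j" using W22 by simp
        have "m3 (W + j) = m2 (W + j)"
          using high_neq[OF h] True by (intro fr) auto
        thus ?thesis using hi2[OF h] S(4)[OF True] init_w[OF j] by simp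
      next
        case False
        hence "W + j = W + 20 + (j - 20)" by simp
        moreover have "j - 20 < ?n" using j by simp
        ultimately have "m3 (W + j) = m2 (22 + (j - 20))"
          using conjunct1[OF A, unfolded r2, rule_format] by presburger
        also have "\<dots> = m1 (2 + j)" using False hi2[of "2 + j"] by simp
        also have "\<dots> = init_mem w k (2 + j)" using False j W22 by (intro S(5)) auto
        finally show ?thesis using init_w[OF j] by simp
      qed
      have z3: "m3 z = 0" if "TB \<le> z" for z
      proof -
        have h: "22 \<le> z" "W + 20 + ?n \<le> z" using that TB by simp_all
        have "m3 z = m2 z" using high_neq[OF h(1)] h(2) by (intro fr) auto
        also have "\<dots> = m1 z" by (rule hi2[OF h(1)])
        also have "\<dots> = init_mem w k z" using h by (intro S(5)) auto
        also have "\<dots> = 0" using h W22 by (intro init_0) simp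
        finally show ?thesis .
      qed
      define m4 where "m4 = m3(3 := 2 * k, 18 := k - 2, 6 := W, 5 := TB, 15 := 0, 4 := TB)"
      have fold4: "fold effect layout_code m3 = m4"
        unfolding layout_code_def m4_def using r3 TB by (simp add: fun_eq_iff)
      show "runs (Basic layout_code ;; size_loop ;; Basic [Add 7 7 6, LoadC 9 0, Add 9 9 4]) m3 (4 * ?n + 71) ?Q"
      proof (rule runs_SeqI[OF runs_Basic[OF _ refl order_refl]])
        fix m4' assume "m4' = fold effect layout_code m3"
        hence m4': "m4' = m4" using fold4 by simp
        have r4: "m4 15 = 0" "m4 2 = 1" "m4 7 = ?n" "m4 4 = TB" "m4 3 = 2 * k" using r3 by (simp_all add: m4_def)
        show "runs (size_loop ;; Basic [Add 7 7 6, LoadC 9 0, Add 9 9 4]) m4' (4 * ?n + 61) ?Q"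
          unfolding m4'
        proof (rule runs_SeqI[OF runs_size_loop[OF r4(2,1)], unfolded r4])
          fix m5 assume B: "m5 4 = TB + ?n * (2 * k) \<and> (\<forall>x. x \<notin> {4, 15} \<longrightarrow> m5 x = m4 x)"
          have fr5: "m5 x = m4 x" if "x \<notin> {4, 15}" for x using B that by blast
          have r5: "m5 4 = TB + ?n * (2 * k)" "m5 0 = W + 20" "m5 1 = k" "m5 2 = 1" "m5 3 = 2 * k" "m5 6 = W" "m5 7 = ?n"
            "m5 5 = TB" "m5 18 = k - 2"
            using B fr5 r3 r4 by (simp_all add: m4_def)
          have h5: "m5 z = m3 z" if "22 \<le> z" for z
            using high_neq[OF that] fr5[of z] by (simp add: m4_def)
          have h6: "fold effect [Add 7 7 6, LoadC 9 0, Add 9 9 4] m5 z = m3 z" if "22 \<le> z" for z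
            using high_neq[OF that] h5[OF that] by simp
          have w6: "fold effect [Add 7 7 6, LoadC 9 0, Add 9 9 4] m5 (W + j) = w ! j" if "j < ?n" for j
            using h6[of "W + j"] w3[OF that] W22 by simp
          have z6: "fold effect [Add 7 7 6, LoadC 9 0, Add 9 9 4] m5 z = 0" if "TB \<le> z" for z
            using h6[of z] z3[OF that] that TB W22 by simp
          have "?Q (fold effect [Add 7 7 6, LoadC 9 0, Add 9 9 4] m5)"
          proof (intro conjI allI impI w6 z6)
          qed (simp_all add: r5 r5(3)[simplified])
          thus "runs (Basic [Add 7 7 6, LoadC 9 0, Add 9 9 4]) m5 60 ?Q"
            by - (rule runs_Basic, simp, assumption, simp)
        qed simp
      qed (simp_all add: layout_code_def)
    qed (use r2 W22 in auto)
  qed (simp_all add: copy_in_code_def list_all_iff)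
qed (simp_all add: save_code_def save_cells_def list_all_iff upt_rec)

text \<open>Each output cell receives the cell \<open>H\<close> places higher. The block copy starts
  at 22 because the lower cells still serve as registers; the 20 cells from 2 on are then loaded by
  straight-line code that relies on cells 0 and 1 only.\<close>

lemma runs_finish:
  assumes m: "m 0 = H" "m 2 = 1" "m 4 = H + 2 + n + n * (2 * k)" and H: "H = n + 40 * k + 20"
  shows "runs finish m (6 * (n + n * (2 * k)) + 60) (\<lambda>m'. \<forall>z<n * (2 * k). m' (2 + n + z) = m (H + 2 + n + z))"
    (is "runs _ _ _ ?Q")
  unfolding finish_def
proof (rule runs_SeqI[OF runs_Basic[OF _ refl order_refl]])
  define N where "N = n + n * (2 * k) - 20"
  fix m1 assume "m1 = fold effect copy_out_code m"
  hence m1: "m1 = m(20 := 22, 19 := 22 + H, 13 := H + 2 + n + n * (2 * k))"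
    using m by (simp add: copy_out_code_def fun_eq_iff)
  have r1: "m1 2 = 1" "m1 19 = 22 + H" "m1 20 = 22" "m1 13 = H + 2 + n + n * (2 * k)" "m1 0 = H"
    using m by (simp_all add: m1)
  have h1: "m1 z = m z" if "22 \<le> z" for z using high_neq[OF that] by (simp add: m1)
  show "runs (copy_loop ;; Basic restore_code) m1 (6 * (n + n * (2 * k)) + 56) ?Q"
  proof (rule runs_SeqI[OF runs_copy_loop[where N = N]])
    fix m2 assume A: "(\<forall>i<N. m2 (m1 20 + i) = m1 (m1 19 + i)) \<and>
       (\<forall>x. x \<notin> {16, 19, 20} \<longrightarrow> \<not> (m1 20 \<le> x \<and> x < m1 20 + N) \<longrightarrow> m2 x = m1 x)"
    have fr: "m2 x = m1 x" if "x \<notin> {16, 19, 20}" "\<not> (22 \<le> x \<and> x < 22 + N)" for x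
      using A that unfolding r1 by blast
    have c: "m2 (22 + i) = m (22 + H + i)" if "i < N" for i
      using A that h1[of "22 + H + i"] unfolding r1 by simp
    define m3 where "m3 = m2(0 := H + 2, 1 := 1)"
    have "m2 0 = H" using fr[of 0] r1 by simp
    hence fold3: "fold effect restore_code m2 = fold effect (restore_cells 20) m3"
      by (simp add: restore_code_def m3_def fun_upd_twist)
    have r3: "m3 1 = 1" "m3 0 = H + 2" "22 \<le> m3 0" using H by (simp_all add: m3_def)
    note F = fold_restore_cells[of m3 20, OF r3(1,3) order_refl, folded fold3, unfolded r3(2)]
    have "fold effect restore_code m2 (2 + n + z) = m (H + 2 + n + z)" if z: "z < n * (2 * k)" for z
    proof (cases "n + z < 20")
      case True
      \<comment> \<open>Since \<open>H\<close> exceeds \<open>40 * k\<close> by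
        \<open>n + 20\<close>, the copied region ends below the cell to be read. If all output fits
        below cell 22, then \<open>N\<close> is zero by truncation and nothing was copied.\<close>
      hence "n * (2 * k) \<le> 20 * (2 * k)" by (intro mult_le_mono1) simp
      hence le: "22 + N \<le> H + 2 + (n + z) \<or> N = 0" unfolding N_def H by linarith
      have hi: "22 \<le> H + 2 + (n + z)" using H by simp
      have "fold effect restore_code m2 (2 + n + z) = m3 (H + 2 + (n + z))"
        using F(1)[OF True] by (simp add: add.assoc)
      also have "\<dots> = m2 (H + 2 + (n + z))" using hi by (simp add: m3_def)
      also have "\<dots> = m1 (H + 2 + (n + z))" 
      proof (rule fr)
        show "H + 2 + (n + z) \<notin> {16, 19, 20}" using high_neq[OF hi] by blast
        show "\<not> (22 \<le> H + 2 + (n + z) \<and> H + 2 + (n + z) < 22 + N)" using le hi by linarith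
      qed
      also have "\<dots> = m (H + 2 + (n + z))" by (rule h1[OF hi])
      finally show ?thesis by (simp add: add.assoc)
    next
      case False
      have "fold effect restore_code m2 (2 + n + z) = m3 (2 + n + z)"
        using False by (intro F(2)) simp
      also have "\<dots> = m2 (22 + (n + z - 20))" using False by (simp add: m3_def)
      also have "\<dots> = m (22 + H + (n + z - 20))"
        using False z by (intro c) (simp add: N_def)
      also have "22 + H + (n + z - 20) = H + 2 + n + z" using False by simp
      finally show ?thesis .
    qed
    hence "?Q (fold effect restore_code m2)" by blast
    thus "runs (Basic restore_code) m2 55 ?Q"
      by - (rule runs_Basic, simp add: restore_code_def restore_cells_def list_all_iff, assumption,
          simp add: restore_code_def restore_cells_def upt_rec)
  qed (use r1 in \<open>auto simp: N_def\<close>)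
qed (simp_all add: copy_out_code_def)

text \<open>The guard tests \<open>k = 0\<close> as \<open>k + n \<le> n\<close>: no register is free at this point.\<close>

definition table_program :: com where
  "table_program = Basic [Add 1 1 0] ;; IfGt 1 0 (prepare ;; main_loop ;; finish)"

lemma runs_table_program:
  assumes w: "\<And>j. j < length w \<Longrightarrow> w ! j \<le> s"
  shows "runs table_program (init_mem w k)
    (if k = 0 then 2 else length w * (9 * s + 61 + k * (5 * s + 44)) + 300)
    (\<lambda>m'. \<forall>i<length w. \<forall>d. \<forall>h\<in>{1..k}. m' (out_addr (length w) k i d h) = rc_table w k i d h)"
    (is "runs _ _ ?T ?Q")
proof -
  let ?n = "length w"
  define m where "m = (init_mem w k)(1 := k + ?n)"
  have fold: "fold effect [Add 1 1 0] (init_mem w k) = m"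
    by (simp add: m_def init_mem_def fun_eq_iff)
  define W where "W = ?n + 40 * k"
  define TB where "TB = W + 22 + ?n"
  have body: "runs (prepare ;; main_loop ;; finish) m (?n * (9 * s + 61 + k * (5 * s + 44)) + 261) ?Q" if k: "1 \<le> k"
  proof (rule runs_SeqI[OF runs_prepare[OF m_def k W_def TB_def]])
    fix m1 assume A: "m1 0 = W + 20 \<and> m1 2 = 1 \<and> m1 1 = k \<and> m1 3 = 2 * k \<and> m1 6 = W \<and> m1 7 = W + ?n \<and>
      m1 5 = TB \<and> m1 4 = TB + ?n * (2 * k) \<and> m1 18 = k - 2 \<and> m1 9 = m1 4 \<and>
      (\<forall>j<?n. m1 (W + j) = w ! j) \<and> (\<forall>z. TB \<le> z \<longrightarrow> m1 z = 0)"
    show "runs (main_loop ;; finish) m1 (?n * (9 * s + 45 + k * (5 * s + 32)) + 1 + (6 * (?n + ?n * (2 * k)) + 60)) ?Q"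
    proof (rule runs_SeqI[OF runs_main_loop[where k = k and W = W and TB = TB and w = w and s = s]])
      fix m2 assume B: "(\<forall>i<?n. \<forall>d. \<forall>g<k. m2 (TB + ((2 * i + orient_code d) * k + g)) = rc_table w k i d (Suc g)) \<and>
        m2 0 = m1 0 \<and> m2 2 = 1 \<and> m2 4 = m1 4"
      show "runs finish m2 (6 * (?n + ?n * (2 * k)) + 60) ?Q"
      proof (rule runs_mono[OF runs_finish[where H = "W + 20" and n = ?n and k = k]])
        fix m3 assume C: "\<forall>z<?n * (2 * k). m3 (2 + ?n + z) = m2 (W + 20 + 2 + ?n + z)"
        show "?Q m3"
        proof (intro allI impI ballI)
          fix i d h assume i: "i < ?n" and h: "h \<in> {1..k}"
          define g where "g = h - 1"
          have g: "g < k" "h = Suc g" using h by (auto simp: g_def)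
          have "2 * i + orient_code d < 2 * ?n" using i by (simp add: orient_code_def)
          hence "(2 * i + orient_code d) * k + g < (2 * ?n) * k"
            unfolding block_less_iff[OF g(1)] .
          moreover have "(2 * ?n) * k = ?n * (2 * k)" by simp
          ultimately have z: "(2 * i + orient_code d) * k + g < ?n * (2 * k)" (is "?z < _")
            by (simp only:)
          have "m3 (2 + ?n + ?z) = m2 (W + 20 + 2 + ?n + ?z)" using C[rule_format, OF z] .
          also have "W + 20 + 2 + ?n + ?z = TB + ?z" unfolding TB_def by presburger
          also have "m2 (TB + ?z) = rc_table w k i d (Suc g)"
            using conjunct1[OF B, rule_format, OF i g(1)] .
          finally show "m3 (out_addr ?n k i d h) = rc_table w k i d h"
            by (simp add: out_addr_def g add.assoc)
        qed
      qed (use A B in \<open>auto simp: TB_def W_def\<close>)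
    qed (use A k w in \<open>auto simp: TB_def W_def\<close>)
  next
    \<comment> \<open>Per position, 10 steps of preparation and 6 of copying raise 45 to 61, and
      copying \<open>2 * k\<close> entries at 6 steps each raises 32 to 44.\<close>
    show "10 * ?n + 200 + (?n * (9 * s + 45 + k * (5 * s + 32)) + 1 + (6 * (?n + ?n * (2 * k)) + 60))
        \<le> ?n * (9 * s + 61 + k * (5 * s + 44)) + 261"
      by (simp add: algebra_simps)
  qed
  show ?thesis
    unfolding table_program_def
  proof (rule runs_SeqI[OF runs_Basic[OF _ refl order_refl]])
    fix m1 assume "m1 = fold effect [Add 1 1 0] (init_mem w k)"
    hence m1: "m1 = m" using fold by simp
    show "runs (IfGt 1 0 (prepare ;; main_loop ;; finish)) m1
        (Suc (if k = 0 then 0 else ?n * (9 * s + 61 + k * (5 * s + 44)) + 261)) ?Q"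
      unfolding m1
    proof (rule runs_If)
      assume "m 0 < m 1"
      hence "1 \<le> k" by (simp add: m_def init_mem_def)
      thus "runs (prepare ;; main_loop ;; finish) m
          (if k = 0 then 0 else ?n * (9 * s + 61 + k * (5 * s + 44)) + 261) ?Q"
        using body by simp
    next
      assume "m 1 \<le> m 0"
      hence "k = 0" by (simp add: m_def init_mem_def)
      thus "?Q m" by simp
    qed
  qed simp_all
qed

theorem theorem13:
  shows "\<exists>(P :: instr list) (c :: nat). \<forall>(w :: nat list) (k :: nat).
           set w = {1..card (set w)} \<longrightarrow>
           computes_table_within P w k (c * (length w * card (set w) * k) + c)"
proof (intro exI[of _ "compile 0 table_program"] exI[of _ 300] allI impI)
  fix w :: "nat list" and k :: nat
  assume w: "set w = {1..card (set w)}"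
  let ?P = "compile 0 table_program"
  let ?n = "length w" and ?s = "card (set w)"
  let ?T = "if k = 0 then 2 else ?n * (9 * ?s + 61 + k * (5 * ?s + 44)) + 300"
  have "w ! j \<le> ?s" if "j < ?n" for j
    using nth_mem[OF that] w by (metis atLeastAtMost_iff)
  from runs_table_program[OF this, of k, unfolded runs_def, rule_format, of "[]" "[]"]
  obtain t m' where t: "t \<le> ?T" "exec ?P t (0, init_mem w k) = (csize table_program, m')"
    "\<forall>i<?n. \<forall>d. \<forall>h\<in>{1..k}. m' (out_addr ?n k i d h) = rc_table w k i d h"
    by auto
  \<comment> \<open>For nonempty \<open>w\<close> and positive \<open>k\<close> each of the four
    terms per position is at most its coefficient times \<open>?s * k\<close>, and 9 + 61 + 5 + 44
    is below 300. Otherwise the additive constant suffices.\<close>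
  have "?T \<le> 300 * (?n * ?s * k) + 300"
  proof (cases "k = 0 \<or> w = []")
    case False
    hence "1 \<le> ?s" by (simp add: Suc_le_eq card_gt_0_iff)
    then obtain s' k' where "?s = Suc s'" "k = Suc k'" using False by (cases "?s"; cases k) auto
    thus ?thesis by (simp add: algebra_simps)
  qed auto
  with t show "computes_table_within ?P w k (300 * (?n * ?s * k) + 300)"
    unfolding computes_table_within_def
    by (intro exI[of _ t]) (simp add: halted_def del: compile.simps)
qed

end
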